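(* Let $\Omega_x,\Omega_y\subset\mathbb{R}$ be bounded domains, $\Omega=\Omega_x\times\Omega_y$, $f\in L^2(\Omega)$, and $g\in H^1_0(\Omega)$ the solution of $-\Delta g=f$ in $\Omega$, $g=0$ on $\partial\Omega$. Let $f_0=f$ and let $(r_n,s_n)_{n\ge1}\subset H^1_0(\Omega_x)\times H^1_0(\Omega_y)$ and $(f_n)_{n\ge1}$ be sequences such that $f_n=f_{n-1}+\Delta(r_n\otimes s_n)$ and, for every $n\ge1$ and all $(r,s)\in H^1_0(\Omega_x)\times H^1_0(\Omega_y)$, $$\int_\Omega\nabla(r_n\otimes s_n)\cdot\nabla(r_n\otimes s+r\otimes s_n)=\int_\Omega f_{n-1}(r_n\otimes s+r\otimes s_n).$$ Let $E_n=\frac12\int_\Omega|\nabla(r_n\otimes s_n)|^2-\int_\Omega f_{n-1}\,r_n\otimes s_n$. Then $$\sum_{n\ge1}\int_\Omega|\nabla(r_n\otimes s_n)|^2=-2\sum_{n\ge1}E_n<\infty.$$ If in addition, for every $n\ge1$, $(r_n,s_n)$ minimizes $(r,s)\mapsto\frac12\int_\Omega|\nabla(r\otimes s)|^2-\int_\Omega f_{n-1}\,r\otimes s$ over $H^1_0(\Omega_x)\times H^1_0(\Omega_y)$ (i.e. the sequence is produced by the Pure Greedy Algorithm), then $g_n:=g-\sum_{k=1}^n r_k\otimes s_k\to0$ in $H^1_0(\Omega)$.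
   Context: Notation: $(r\otimes s)(x,y)=r(x)s(y)$. For $h\in H^{-1}(\Omega)$ and $u\in H^1_0(\Omega)$, $\int_\Omega h\,u$ denotes the duality pairing. *)

theory Defs
  imports "HOL-Analysis.Analysis"
begin

definition L2 :: "'a::euclidean_space set \<Rightarrow> ('a \<Rightarrow> real) set" where
  "L2 U = {u. u \<in> borel_measurable (lebesgue_on U) \<and>
               integrable (lebesgue_on U) (\<lambda>x. (u x)\<^sup>2)}"

definition L2vec :: "'a::euclidean_space set \<Rightarrow> ('a \<Rightarrow> 'a) set" where
  "L2vec U = {G. G \<in> borel_measurable (lebesgue_on U) \<and>
               integrable (lebesgue_on U) (\<lambda>x. (norm (G x))\<^sup>2)}"

text \<open>C-infinity functions on the whole space: every iterated partial derivative exists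
  everywhere and is continuous (largest family closed under taking partial derivatives).\<close>
definition smooth_fun :: "('a::euclidean_space \<Rightarrow> real) \<Rightarrow> bool" where
  "smooth_fun \<phi> \<longleftrightarrow> (\<exists>D. \<phi> \<in> D \<and>
     (\<forall>h\<in>D. continuous_on UNIV h \<and> (\<forall>x. h differentiable (at x)) \<and>
              (\<forall>i\<in>Basis. (\<lambda>x. frechet_derivative h (at x) i) \<in> D)))"

definition test_fun :: "'a::euclidean_space set \<Rightarrow> ('a \<Rightarrow> real) \<Rightarrow> bool" where
  "test_fun U \<phi> \<longleftrightarrow> smooth_fun \<phi> \<and> compact (closure {x. \<phi> x \<noteq> 0}) \<and>
                      closure {x. \<phi> x \<noteq> 0} \<subseteq> U"

definition cgrad :: "('a::euclidean_space \<Rightarrow> real) \<Rightarrow> 'a \<Rightarrow> 'a" where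
  "cgrad \<phi> x = (\<Sum>i\<in>Basis. frechet_derivative \<phi> (at x) i *\<^sub>R i)"

text \<open>H^1_0(U) = closure of C_c^infinity(U) in the H^1 norm; G is the (weak) gradient of u.\<close>
definition is_H10_grad :: "'a::euclidean_space set \<Rightarrow> ('a \<Rightarrow> real) \<Rightarrow> ('a \<Rightarrow> 'a) \<Rightarrow> bool" where
  "is_H10_grad U u G \<longleftrightarrow> u \<in> L2 U \<and> G \<in> L2vec U \<and>
     (\<exists>\<phi>::nat \<Rightarrow> 'a \<Rightarrow> real. (\<forall>k. test_fun U (\<phi> k)) \<and>
        (\<lambda>k. integral\<^sup>L (lebesgue_on U) (\<lambda>x. (\<phi> k x - u x)\<^sup>2)) \<longlonglongrightarrow> 0 \<and>
        (\<lambda>k. integral\<^sup>L (lebesgue_on U) (\<lambda>x. (norm (cgrad (\<phi> k) x - G x))\<^sup>2)) \<longlonglongrightarrow> 0)"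

definition H10 :: "'a::euclidean_space set \<Rightarrow> ('a \<Rightarrow> real) set" where
  "H10 U = {u. \<exists>G. is_H10_grad U u G}"

definition H10_grad :: "'a::euclidean_space set \<Rightarrow> ('a \<Rightarrow> real) \<Rightarrow> 'a \<Rightarrow> 'a" where
  "H10_grad U u = (SOME G. is_H10_grad U u G)"

definition dirichlet :: "'a::euclidean_space set \<Rightarrow> ('a \<Rightarrow> real) \<Rightarrow> ('a \<Rightarrow> real) \<Rightarrow> real" where
  "dirichlet U u v = integral\<^sup>L (lebesgue_on U) (\<lambda>x. H10_grad U u x \<bullet> H10_grad U v x)"

definition tensor :: "(real \<Rightarrow> real) \<Rightarrow> (real \<Rightarrow> real) \<Rightarrow> real \<times> real \<Rightarrow> real" where
  "tensor r s = (\<lambda>(x, y). r x * s y)"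

definition bounded_domain :: "'a::euclidean_space set \<Rightarrow> bool" where
  "bounded_domain U \<longleftrightarrow> U \<noteq> {} \<and> open U \<and> connected U \<and> bounded U"

end

theory Submission
  imports Defs "HOL-Library.Function_Algebras"
begin

text \<open>
  Write \<open>t\<^sub>n = r\<^sub>n \<otimes> s\<^sub>n\<close> and \<open>\<langle>u, v\<rangle>\<close> for the Dirichlet form. Then \<open>f\<^sub>n\<close> is represented by \<open>g\<^sub>n\<close>,
  and the Galerkin equation tested with \<open>(r\<^sub>n, s\<^sub>n)\<close> says \<open>\<langle>g\<^sub>n\<^sub>-\<^sub>1, t\<^sub>n\<rangle> = \<langle>t\<^sub>n, t\<^sub>n\<rangle>\<close>. Hence
  \<open>E\<^sub>n = - \<langle>t\<^sub>n, t\<^sub>n\<rangle> / 2\<close> and the energy of \<open>g\<^sub>n\<close> drops by \<open>\<langle>t\<^sub>n, t\<^sub>n\<rangle>\<close> in each step, which gives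
  the first part.

  If the steps are minimizing, then \<open>\<bar>\<langle>g\<^sub>n, v\<rangle>\<bar> \<le> a\<^sub>n \<parallel>v\<parallel>\<close> for all tensor products \<open>v\<close>, where
  \<open>a\<^sub>n = \<parallel>t\<^sub>n\<^sub>+\<^sub>1\<parallel>\<close> is square summable. In \<open>\<parallel>g\<^sub>n\<parallel>\<^sup>2 = \<langle>g\<^sub>n, g\<rangle> - (\<Sum>k=1..n. \<langle>g\<^sub>n, t\<^sub>k\<rangle>)\<close> the sum is
  therefore at most \<open>a\<^sub>n (\<Sum>k<n. a\<^sub>k)\<close>, which is small along a subsequence, and the first term
  becomes small because \<open>g\<close> can be approximated by finite sums of tensor products. Since \<open>\<parallel>g\<^sub>n\<parallel>\<close>
  decreases, this suffices; no completeness of \<open>H\<^sup>1\<^sub>0\<close> is needed.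
\<close>

subsection \<open>Functions as vectors\<close>

instantiation "fun" :: (type, real_vector) real_vector
begin

definition scaleR_fun_def: "c *\<^sub>R f = (\<lambda>x. c *\<^sub>R f x)"

instance
  by standard (simp_all add: scaleR_fun_def fun_eq_iff algebra_simps)

end

lemma scaleR_fun_apply [simp]: "(c *\<^sub>R f) x = c *\<^sub>R f x"
  by (simp add: scaleR_fun_def)

instance "fun" :: (type, real_algebra) real_algebra
  by standard (simp_all add: fun_eq_iff)

lemma sum_fun_apply [simp]:
  fixes f :: "'i \<Rightarrow> 'a \<Rightarrow> 'b::comm_monoid_add"
  shows "(\<Sum>i\<in>A. f i) x = (\<Sum>i\<in>A. f i x)"
  by (induction A rule: infinite_finite_induct) simp_all

lemma span_mult:
  fixes S T R :: "'a::real_algebra set"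
  assumes generators: "\<And>f g. f \<in> S \<Longrightarrow> g \<in> T \<Longrightarrow> f * g \<in> span R"
    and "f \<in> span S" "g \<in> span T"
  shows "f * g \<in> span R"
proof -
  have "\<forall>g\<in>T. f * g \<in> span R"
    using \<open>f \<in> span S\<close>
    by (induction rule: span_induct_alt)
      (auto simp: distrib_right intro: span_zero span_add span_scale generators)
  with \<open>g \<in> span T\<close> show ?thesis
    by (induction rule: span_induct_alt)
      (auto simp: distrib_left intro: span_zero span_add span_scale)
qed

lemma span_zero_fun: "(\<lambda>_. 0 :: 'b::real_vector) \<in> span S"
  using span_zero[of S] by (simp add: zero_fun_def)

subsection \<open>Semi-inner products\<close>

lemma quadratic_nonneg_discriminant:
  fixes A B C :: real
  assumes nonneg: "\<And>t. 0 \<le> A + 2 * t * B + t\<^sup>2 * C" and "0 \<le> C"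
  shows "B\<^sup>2 \<le> A * C"
proof (cases "C = 0")
  case True
  have "B = 0"
    using nonneg[of "- (A + 1) / (2 * B)"] True by (cases "B = 0") (simp_all add: field_simps)
  then show ?thesis using True by simp
next
  case False
  then have "C > 0" using \<open>0 \<le> C\<close> by simp
  have "0 \<le> A + 2 * (- B / C) * B + (- B / C)\<^sup>2 * C" by (rule nonneg)
  also have "\<dots> = A - B\<^sup>2 / C"
    using \<open>C > 0\<close> by (simp add: field_simps power2_eq_square)
  finally show ?thesis
    using \<open>C > 0\<close> by (simp add: field_simps)
qed

lemma quadratic_nonneg_imp_abs_le:
  fixes A B C :: real
  assumes "\<And>t. 0 \<le> A + 2 * t * B + t\<^sup>2 * C" and "0 \<le> C"
  shows "\<bar>B\<bar> \<le> sqrt A * sqrt C"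
  using real_sqrt_le_mono[OF quadratic_nonneg_discriminant[OF assms]] by (simp add: real_sqrt_mult)

definition form_norm :: "('v \<Rightarrow> 'v \<Rightarrow> real) \<Rightarrow> 'v \<Rightarrow> real" where
  "form_norm form u = sqrt (form u u)"

locale semi_inner_product =
  fixes V :: "'v::real_vector set"
    and form :: "'v \<Rightarrow> 'v \<Rightarrow> real"  (\<open>\<langle>_, _\<rangle>\<close>)
  assumes subspace_V: "subspace V"
    and form_commute: "u \<in> V \<Longrightarrow> v \<in> V \<Longrightarrow> \<langle>u, v\<rangle> = \<langle>v, u\<rangle>"
    and form_add_left: "u \<in> V \<Longrightarrow> v \<in> V \<Longrightarrow> w \<in> V \<Longrightarrow> \<langle>u + v, w\<rangle> = \<langle>u, w\<rangle> + \<langle>v, w\<rangle>"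
    and form_scaleR_left: "u \<in> V \<Longrightarrow> v \<in> V \<Longrightarrow> \<langle>c *\<^sub>R u, v\<rangle> = c * \<langle>u, v\<rangle>"
    and form_nonneg: "u \<in> V \<Longrightarrow> 0 \<le> \<langle>u, u\<rangle>"
begin

abbreviation seminorm :: "'v \<Rightarrow> real"  (\<open>\<parallel>_\<parallel>\<close>)
  where "\<parallel>u\<parallel> \<equiv> form_norm form u"

lemmas closed = subspace_0[OF subspace_V] subspace_add[OF subspace_V]
  subspace_scale[OF subspace_V] subspace_diff[OF subspace_V] subspace_sum[OF subspace_V]

lemma form_add_right:
  "u \<in> V \<Longrightarrow> v \<in> V \<Longrightarrow> w \<in> V \<Longrightarrow> \<langle>w, u + v\<rangle> = \<langle>w, u\<rangle> + \<langle>w, v\<rangle>"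
  using form_add_left[of u v w] by (simp add: form_commute closed)

lemma form_scaleR_right: "u \<in> V \<Longrightarrow> v \<in> V \<Longrightarrow> \<langle>v, c *\<^sub>R u\<rangle> = c * \<langle>v, u\<rangle>"
  using form_scaleR_left[of u v c] by (simp add: form_commute closed)

lemma form_diff_left:
  "u \<in> V \<Longrightarrow> v \<in> V \<Longrightarrow> w \<in> V \<Longrightarrow> \<langle>u - v, w\<rangle> = \<langle>u, w\<rangle> - \<langle>v, w\<rangle>"
  using form_add_left[of "u - v" v w] by (simp add: closed)

lemma form_diff_right:
  "u \<in> V \<Longrightarrow> v \<in> V \<Longrightarrow> w \<in> V \<Longrightarrow> \<langle>w, u - v\<rangle> = \<langle>w, u\<rangle> - \<langle>w, v\<rangle>"
  using form_add_right[of "u - v" v w] by (simp add: closed)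

lemma form_zero_right: "u \<in> V \<Longrightarrow> \<langle>u, 0\<rangle> = 0"
  using form_scaleR_right[of u u 0] by simp

lemma form_sum_right:
  assumes "w \<in> V" "\<And>i. i \<in> A \<Longrightarrow> u i \<in> V"
  shows "\<langle>w, \<Sum>i\<in>A. u i\<rangle> = (\<Sum>i\<in>A. \<langle>w, u i\<rangle>)"
  using assms(2)
  by (induction A rule: infinite_finite_induct)
    (simp_all add: form_zero_right form_add_right closed \<open>w \<in> V\<close>)

lemma form_add_scaleR_self:
  assumes "u \<in> V" "v \<in> V"
  shows "\<langle>u + t *\<^sub>R v, u + t *\<^sub>R v\<rangle> = \<langle>u, u\<rangle> + 2 * t * \<langle>u, v\<rangle> + t\<^sup>2 * \<langle>v, v\<rangle>"
  using assms form_commute[of v u]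
  by (simp add: form_add_left form_add_right form_scaleR_left form_scaleR_right closed
      power2_eq_square algebra_simps)

lemma seminorm_nonneg: "u \<in> V \<Longrightarrow> 0 \<le> \<parallel>u\<parallel>"
  by (simp add: form_norm_def form_nonneg)

lemma power2_seminorm: "u \<in> V \<Longrightarrow> \<parallel>u\<parallel>\<^sup>2 = \<langle>u, u\<rangle>"
  by (simp add: form_norm_def form_nonneg)

lemma Cauchy_Schwarz:
  assumes "u \<in> V" "v \<in> V"
  shows "\<bar>\<langle>u, v\<rangle>\<bar> \<le> \<parallel>u\<parallel> * \<parallel>v\<parallel>"
  unfolding form_norm_def
proof (rule quadratic_nonneg_imp_abs_le)
  show "0 \<le> \<langle>u, u\<rangle> + 2 * t * \<langle>u, v\<rangle> + t\<^sup>2 * \<langle>v, v\<rangle>" for t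
    using form_nonneg[of "u + t *\<^sub>R v"] assms by (simp add: form_add_scaleR_self closed)
qed (simp add: form_nonneg assms)

lemma seminorm_scaleR: "u \<in> V \<Longrightarrow> \<parallel>c *\<^sub>R u\<parallel> = \<bar>c\<bar> * \<parallel>u\<parallel>"
  by (simp add: form_norm_def form_scaleR_left form_scaleR_right closed real_sqrt_mult
      flip: mult.assoc power2_eq_square)

lemma seminorm_minus_commute: "u \<in> V \<Longrightarrow> v \<in> V \<Longrightarrow> \<parallel>u - v\<parallel> = \<parallel>v - u\<parallel>"
  using seminorm_scaleR[of "v - u" "- 1"] by (simp add: closed)

lemma seminorm_triangle:
  assumes "u \<in> V" "v \<in> V"
  shows "\<parallel>u + v\<parallel> \<le> \<parallel>u\<parallel> + \<parallel>v\<parallel>"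
proof (rule power2_le_imp_le)
  have "\<parallel>u + v\<parallel>\<^sup>2 = \<parallel>u\<parallel>\<^sup>2 + 2 * \<langle>u, v\<rangle> + \<parallel>v\<parallel>\<^sup>2"
    using form_add_scaleR_self[OF assms, of 1] assms by (simp add: power2_seminorm closed)
  also have "\<dots> \<le> \<parallel>u\<parallel>\<^sup>2 + 2 * (\<parallel>u\<parallel> * \<parallel>v\<parallel>) + \<parallel>v\<parallel>\<^sup>2"
    using Cauchy_Schwarz[OF assms] by simp
  finally show "\<parallel>u + v\<parallel>\<^sup>2 \<le> (\<parallel>u\<parallel> + \<parallel>v\<parallel>)\<^sup>2"
    by (simp add: power2_sum algebra_simps)
qed (simp add: seminorm_nonneg assms)

lemma seminorm_diff_triangle:
  "u \<in> V \<Longrightarrow> v \<in> V \<Longrightarrow> w \<in> V \<Longrightarrow> \<parallel>u - w\<parallel> \<le> \<parallel>u - v\<parallel> + \<parallel>v - w\<parallel>"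
  using seminorm_triangle[of "u - v" "v - w"] by (simp add: closed)

lemma seminorm_diff_ineq:
  assumes "u \<in> V" "v \<in> V"
  shows "\<bar>\<parallel>u\<parallel> - \<parallel>v\<parallel>\<bar> \<le> \<parallel>u - v\<parallel>"
  using seminorm_diff_triangle[of u v 0] seminorm_diff_triangle[of v u 0]
    seminorm_minus_commute[OF assms] assms by (simp add: closed)

context
  fixes F :: "nat \<Rightarrow> 'v" and u :: 'v
  assumes F: "\<And>n. F n \<in> V" and u: "u \<in> V" and F_lim: "(\<lambda>n. \<parallel>F n - u\<parallel>) \<longlonglongrightarrow> 0"
begin

lemma tendsto_form_left:
  assumes "v \<in> V"
  shows "(\<lambda>n. \<langle>F n, v\<rangle>) \<longlonglongrightarrow> \<langle>u, v\<rangle>"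
proof -
  have "(\<lambda>n. \<langle>F n - u, v\<rangle>) \<longlonglongrightarrow> 0"
  proof (rule Lim_null_comparison)
    show "\<forall>\<^sub>F n in sequentially. norm \<langle>F n - u, v\<rangle> \<le> \<parallel>F n - u\<parallel> * \<parallel>v\<parallel>"
      using Cauchy_Schwarz F u assms by (simp add: closed)
  qed (rule tendsto_mult_left_zero[OF F_lim])
  then show ?thesis
    using F u assms by (simp add: form_diff_left LIM_zero_iff)
qed

lemma tendsto_seminorm: "(\<lambda>n. \<parallel>F n\<parallel>) \<longlonglongrightarrow> \<parallel>u\<parallel>"
proof -
  have "(\<lambda>n. \<parallel>F n\<parallel> - \<parallel>u\<parallel>) \<longlonglongrightarrow> 0"
    using F_lim
    by (rule Lim_null_comparison[rotated]) (use seminorm_diff_ineq F u in simp)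
  then show ?thesis by (simp add: LIM_zero_iff)
qed

lemma seminorm_tendsto_scaleR: "(\<lambda>n. \<parallel>c *\<^sub>R F n - c *\<^sub>R u\<parallel>) \<longlonglongrightarrow> 0"
  using tendsto_mult_right_zero[OF F_lim, of "\<bar>c\<bar>"] F u
  by (simp add: seminorm_scaleR closed flip: scaleR_diff_right)

lemma seminorm_tendsto_add:
  assumes "\<And>n. G n \<in> V" "v \<in> V" "(\<lambda>n. \<parallel>G n - v\<parallel>) \<longlonglongrightarrow> 0"
  shows "(\<lambda>n. \<parallel>(F n + G n) - (u + v)\<parallel>) \<longlonglongrightarrow> 0"
proof (rule Lim_null_comparison)
  show "\<forall>\<^sub>F n in sequentially. norm \<parallel>(F n + G n) - (u + v)\<parallel> \<le> \<parallel>F n - u\<parallel> + \<parallel>G n - v\<parallel>"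
    using seminorm_triangle[of "F n - u" "G n - v" for n] F u assms
    by (simp add: add_diff_add closed seminorm_nonneg)
  show "(\<lambda>n. \<parallel>F n - u\<parallel> + \<parallel>G n - v\<parallel>) \<longlonglongrightarrow> 0"
    using tendsto_add[OF F_lim assms(3)] by simp
qed

end

end

subsection \<open>Greedy expansions\<close>

definition residual :: "'v::ab_group_add \<Rightarrow> (nat \<Rightarrow> 'v) \<Rightarrow> nat \<Rightarrow> 'v" where
  "residual g t n = g - (\<Sum>k<n. t k)"

lemma residual_0 [simp]: "residual g t 0 = g"
  by (simp add: residual_def)

lemma residual_Suc: "residual g t (Suc n) = residual g t n - t n"
  by (simp add: residual_def)

text \<open>The indices are shifted: \<open>t n\<close> stands for \<open>r\<^sub>n\<^sub>+\<^sub>1 \<otimes> s\<^sub>n\<^sub>+\<^sub>1\<close>, and \<open>l n\<close> for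
  the functional \<open>f\<^sub>n\<close>.\<close>

locale residual_functionals = semi_inner_product V form
  for V :: "'v::real_vector set" and form (\<open>\<langle>_, _\<rangle>\<close>) +
  fixes g :: 'v and t :: "nat \<Rightarrow> 'v" and l :: "nat \<Rightarrow> 'v \<Rightarrow> real"
  assumes g_mem: "g \<in> V"
    and step_mem: "t n \<in> V"
    and functional_0: "v \<in> V \<Longrightarrow> l 0 v = \<langle>g, v\<rangle>"
    and functional_Suc: "v \<in> V \<Longrightarrow> l (Suc n) v = l n v - \<langle>t n, v\<rangle>"
begin

lemma residual_mem: "residual g t n \<in> V"
  by (simp add: residual_def closed g_mem step_mem)

lemma functional_eq: "v \<in> V \<Longrightarrow> l n v = \<langle>residual g t n, v\<rangle>"
  by (induction n)
    (simp_all add: functional_0 functional_Suc residual_Suc form_diff_left residual_mem step_mem)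

lemma functional_eq_form_of_add_self:
  assumes "v \<in> V" and "\<langle>t n, v + v\<rangle> = l n (v + v)"
  shows "l n v = \<langle>t n, v\<rangle>"
proof -
  have "\<langle>t n, v\<rangle> + \<langle>t n, v\<rangle> = l n v + l n v"
    using assms
    by (simp only: functional_eq form_add_right closed residual_mem step_mem)
  then show ?thesis by simp
qed

end

locale galerkin_steps = residual_functionals +
  assumes galerkin: "l n (t n) = \<langle>t n, t n\<rangle>"
begin

lemma energy_residual_Suc:
  "\<langle>residual g t (Suc n), residual g t (Suc n)\<rangle> = \<langle>residual g t n, residual g t n\<rangle> - \<langle>t n, t n\<rangle>"
  using form_add_scaleR_self[OF residual_mem step_mem, of n "- 1" n] galerkin[of n]
  by (simp add: residual_Suc functional_eq step_mem)

lemma sum_energy_steps: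
  "(\<Sum>k<n. \<langle>t k, t k\<rangle>) = \<langle>g, g\<rangle> - \<langle>residual g t n, residual g t n\<rangle>"
  by (induction n) (simp_all add: energy_residual_Suc)

lemma summable_energy_steps: "summable (\<lambda>n. \<langle>t n, t n\<rangle>)"
proof (rule summableI_nonneg_bounded)
  show "(\<Sum>k<n. \<langle>t k, t k\<rangle>) \<le> \<langle>g, g\<rangle>" for n
    by (simp add: sum_energy_steps form_nonneg residual_mem)
qed (simp add: form_nonneg step_mem)

lemma decseq_energy_residual: "decseq (\<lambda>n. \<langle>residual g t n, residual g t n\<rangle>)"
  by (simp add: decseq_Suc_iff energy_residual_Suc form_nonneg step_mem)

lemma step_objective_sums:
  "(\<lambda>n. 1/2 * \<langle>t n, t n\<rangle> - l n (t n)) sums (- (1/2) * (\<Sum>n. \<langle>t n, t n\<rangle>))"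
  using sums_mult[OF summable_sums[OF summable_energy_steps], of "- (1/2)"]
  by (simp add: galerkin)

end

lemma sum_lessThan_power2_le_suminf:
  fixes a :: "nat \<Rightarrow> real"
  assumes "summable (\<lambda>n. (a n)\<^sup>2)"
  shows "(\<Sum>k<m. a k)\<^sup>2 \<le> real m * (\<Sum>n. (a n)\<^sup>2)"
proof -
  have "(\<Sum>k<m. a k)\<^sup>2 \<le> real m * (\<Sum>k<m. (a k)\<^sup>2)"
    using sum_squared_le_sum_of_squares[of a "{..<m}"] by (simp add: mult.commute)
  also have "(\<Sum>k<m. (a k)\<^sup>2) \<le> (\<Sum>n. (a n)\<^sup>2)"
    using assms by (intro sum_le_suminf) simp_all
  finally show ?thesis by (simp add: mult_left_mono)
qed

text \<open>Otherwise \<open>a\<^sub>m\<^sup>2 \<ge> c / m\<close> for all large \<open>m\<close>, because the sum is \<open>O(\<surd>m)\<close> by Cauchy--Schwarz.\<close>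

lemma frequently_mult_sum_less_of_summable_power2:
  fixes a :: "nat \<Rightarrow> real"
  assumes summable: "summable (\<lambda>n. (a n)\<^sup>2)" and "\<epsilon> > 0"
  shows "\<exists>\<^sub>F m in sequentially. a m * (\<Sum>k<m. a k) < \<epsilon>"
proof -
  define A where "A = (\<Sum>n. (a n)\<^sup>2) + 1"
  have "A > 0"
    unfolding A_def using suminf_nonneg[OF summable] by (simp add: add_nonneg_pos)
  have harmonic_le: "\<epsilon>\<^sup>2 / A * inverse (real m) \<le> (a m)\<^sup>2"
    if "\<epsilon> \<le> a m * (\<Sum>k<m. a k)" "m \<ge> 1" for m
  proof -
    have "\<epsilon>\<^sup>2 \<le> (a m)\<^sup>2 * (\<Sum>k<m. a k)\<^sup>2"
      using power_mono[OF that(1), of 2] \<open>\<epsilon> > 0\<close> by (simp add: power_mult_distrib)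
    also have "\<dots> \<le> (a m)\<^sup>2 * (real m * A)"
      using sum_lessThan_power2_le_suminf[OF summable, of m]
      by (intro mult_left_mono) (simp_all add: A_def distrib_left)
    finally show ?thesis
      using \<open>A > 0\<close> that(2) by (simp add: field_simps)
  qed
  show ?thesis
  proof (rule ccontr)
    assume "\<not> ?thesis"
    then obtain N where "\<And>m. m \<ge> N \<Longrightarrow> \<epsilon> \<le> a m * (\<Sum>k<m. a k)"
      by (force simp: frequently_def eventually_sequentially)
    then have "summable (\<lambda>m. \<epsilon>\<^sup>2 / A * inverse (real m))"
      using harmonic_le \<open>A > 0\<close>
      by (intro summable_comparison_test'[OF summable, of "max N 1"]) simp
    then have "summable (\<lambda>m. inverse (real m))"
      using \<open>A > 0\<close> \<open>\<epsilon> > 0\<close> by (subst (asm) summable_cmult_iff) simp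
    then show False
      using not_summable_harmonic[where ?'a = real] by simp
  qed
qed

lemma decseq_tendsto_0:
  fixes X :: "nat \<Rightarrow> real"
  assumes "decseq X" "\<And>n. 0 \<le> X n" "\<And>e. e > 0 \<Longrightarrow> \<exists>n. X n < e"
  shows "X \<longlonglongrightarrow> 0"
proof (rule LIMSEQ_I)
  fix e :: real assume "e > 0"
  then obtain n where "X n < e"
    using assms(3) by blast
  then have "norm (X m - 0) < e" if "m \<ge> n" for m
    using decseqD[OF assms(1) that] assms(2)[of m] by simp
  then show "\<exists>n. \<forall>m\<ge>n. norm (X m - 0) < e" by blast
qed

locale pure_greedy = residual_functionals V form g t l
  for V :: "'v::real_vector set" and form (\<open>\<langle>_, _\<rangle>\<close>) and g t l +
  fixes \<D> :: "'v set"
  assumes dictionary_subset: "\<D> \<subseteq> V"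
    and dictionary_scaleR: "v \<in> \<D> \<Longrightarrow> c *\<^sub>R v \<in> \<D>"
    and step_in_dictionary: "t n \<in> \<D>"
    and step_minimal: "v \<in> \<D> \<Longrightarrow> 1/2 * \<langle>t n, t n\<rangle> - l n (t n) \<le> 1/2 * \<langle>v, v\<rangle> - l n v"
begin

lemma step_minimal_scaleR:
  assumes "v \<in> \<D>"
  shows "1/2 * \<langle>t n, t n\<rangle> - l n (t n) \<le> 1/2 * c\<^sup>2 * \<langle>v, v\<rangle> - c * l n v"
proof -
  have "v \<in> V"
    using assms dictionary_subset by blast
  then show ?thesis
    using step_minimal[OF dictionary_scaleR[OF assms], of n c]
    by (simp add: functional_eq form_scaleR_left form_scaleR_right closed residual_mem
        power2_eq_square)
qed

sublocale galerkin_steps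
proof
  fix n
  have "(\<langle>t n, t n\<rangle> - l n (t n))\<^sup>2 \<le> 0 * \<langle>t n, t n\<rangle>"
  proof (rule quadratic_nonneg_discriminant)
    show "0 \<le> 0 + 2 * c * (\<langle>t n, t n\<rangle> - l n (t n)) + c\<^sup>2 * \<langle>t n, t n\<rangle>" for c
      using step_minimal_scaleR[OF step_in_dictionary, of n "1 + c" n]
      by (simp add: power2_eq_square algebra_simps)
  qed (simp add: form_nonneg step_mem)
  then show "l n (t n) = \<langle>t n, t n\<rangle>" by simp
qed

lemma form_residual_dictionary_le:
  assumes "v \<in> \<D>"
  shows "\<bar>\<langle>residual g t n, v\<rangle>\<bar> \<le> \<parallel>t n\<parallel> * \<parallel>v\<parallel>"
  unfolding form_norm_def
proof (rule quadratic_nonneg_imp_abs_le)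
  have "v \<in> V"
    using assms dictionary_subset by blast
  then show "0 \<le> \<langle>t n, t n\<rangle> + 2 * c * \<langle>residual g t n, v\<rangle> + c\<^sup>2 * \<langle>v, v\<rangle>" for c
    using step_minimal_scaleR[OF assms, of n "- c"] by (simp add: galerkin functional_eq[of v])
  from \<open>v \<in> V\<close> show "0 \<le> \<langle>v, v\<rangle>"
    by (rule form_nonneg)
qed

lemma span_dictionary_subset: "span \<D> \<subseteq> V"
  by (rule span_minimal[OF dictionary_subset subspace_V])

lemma summable_power2_seminorm_step: "summable (\<lambda>n. \<parallel>t n\<parallel>\<^sup>2)"
  using summable_energy_steps by (simp add: power2_seminorm step_mem)

lemma form_residual_span_tendsto_0:
  assumes "S \<in> span \<D>"
  shows "(\<lambda>n. \<langle>residual g t n, S\<rangle>) \<longlonglongrightarrow> 0"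
proof -
  let ?L = "{S \<in> V. (\<lambda>n. \<langle>residual g t n, S\<rangle>) \<longlonglongrightarrow> 0}"
  have "span \<D> \<subseteq> ?L"
  proof (rule span_minimal)
    have "(\<lambda>n. \<langle>residual g t n, v\<rangle>) \<longlonglongrightarrow> 0" if "v \<in> \<D>" for v
    proof (rule Lim_null_comparison)
      show "\<forall>\<^sub>F n in sequentially. norm \<langle>residual g t n, v\<rangle> \<le> \<parallel>t n\<parallel> * \<parallel>v\<parallel>"
        by (simp add: form_residual_dictionary_le that)
      show "(\<lambda>n. \<parallel>t n\<parallel> * \<parallel>v\<parallel>) \<longlonglongrightarrow> 0"
        using tendsto_real_sqrt[OF summable_LIMSEQ_zero[OF summable_energy_steps]]
        by (intro tendsto_mult_left_zero) (simp add: form_norm_def)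
    qed
    then show "\<D> \<subseteq> ?L"
      using dictionary_subset by blast
    show "subspace ?L"
      by (rule subspaceI)
        (auto simp: form_zero_right form_add_right form_scaleR_right closed residual_mem
          intro: tendsto_add_zero tendsto_mult_right_zero)
  qed
  then show ?thesis using assms by blast
qed

lemma abs_form_residual_sum_steps_le:
  "\<bar>\<langle>residual g t n, \<Sum>k<m. t k\<rangle>\<bar> \<le> \<parallel>t n\<parallel> * (\<Sum>k<m. \<parallel>t k\<parallel>)"
proof -
  have "\<bar>\<langle>residual g t n, \<Sum>k<m. t k\<rangle>\<bar> \<le> (\<Sum>k<m. \<bar>\<langle>residual g t n, t k\<rangle>\<bar>)"
    by (simp add: form_sum_right residual_mem step_mem)
  also have "\<dots> \<le> (\<Sum>k<m. \<parallel>t n\<parallel> * \<parallel>t k\<parallel>)"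
    by (intro sum_mono form_residual_dictionary_le step_in_dictionary)
  finally show ?thesis by (simp add: sum_distrib_left)
qed

lemma energy_residual_le:
  assumes "S \<in> V"
  shows "\<langle>residual g t n, residual g t n\<rangle>
    \<le> \<parallel>g\<parallel> * \<parallel>g - S\<parallel> + \<langle>residual g t n, S\<rangle> + \<parallel>t n\<parallel> * (\<Sum>k<n. \<parallel>t k\<parallel>)"
proof -
  let ?r = "residual g t n" and ?T = "\<Sum>k<n. t k"
  have "\<parallel>?r\<parallel> \<le> \<parallel>g\<parallel>"
    using decseqD[OF decseq_energy_residual, of 0 n] by (simp add: form_norm_def)
  then have "\<parallel>?r\<parallel> * \<parallel>g - S\<parallel> \<le> \<parallel>g\<parallel> * \<parallel>g - S\<parallel>"
    using assms by (intro mult_right_mono seminorm_nonneg) (simp_all add: closed g_mem)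
  moreover have "\<bar>\<langle>?r, g - S\<rangle>\<bar> \<le> \<parallel>?r\<parallel> * \<parallel>g - S\<parallel>"
    using assms by (intro Cauchy_Schwarz) (simp_all add: closed g_mem residual_mem)
  moreover have "\<langle>?r, ?r\<rangle> = \<langle>?r, g - S\<rangle> + \<langle>?r, S\<rangle> - \<langle>?r, ?T\<rangle>"
    using assms by (subst (2) residual_def)
      (simp add: form_diff_right closed residual_mem g_mem step_mem)
  ultimately show ?thesis
    using abs_form_residual_sum_steps_le[of n n] by linarith
qed

lemma energy_residual_less_exists:
  assumes dense: "\<And>\<epsilon>. \<epsilon> > 0 \<Longrightarrow> \<exists>S\<in>span \<D>. \<parallel>g - S\<parallel> \<le> \<epsilon>" and "e > 0"
  shows "\<exists>n. \<langle>residual g t n, residual g t n\<rangle> < e"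
proof -
  define \<epsilon> where "\<epsilon> = e / 3 / (\<parallel>g\<parallel> + 1)"
  have "\<epsilon> > 0" "\<parallel>g\<parallel> * \<epsilon> \<le> e / 3"
    using \<open>e > 0\<close> seminorm_nonneg[OF g_mem] by (simp_all add: \<epsilon>_def field_simps)
  obtain S where S: "S \<in> span \<D>" "\<parallel>g - S\<parallel> \<le> \<epsilon>"
    using dense[OF \<open>\<epsilon> > 0\<close>] by blast
  then have "S \<in> V"
    using span_dictionary_subset by blast
  have "\<parallel>g\<parallel> * \<parallel>g - S\<parallel> \<le> e / 3"
    using mult_left_mono[OF S(2) seminorm_nonneg[OF g_mem]] \<open>\<parallel>g\<parallel> * \<epsilon> \<le> e / 3\<close> by linarith
  moreover have "\<forall>\<^sub>F n in sequentially. \<langle>residual g t n, S\<rangle> < e / 3"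
    using form_residual_span_tendsto_0[OF S(1)] \<open>e > 0\<close> by (intro order_tendstoD) auto
  moreover have "\<exists>\<^sub>F n in sequentially. \<parallel>t n\<parallel> * (\<Sum>k<n. \<parallel>t k\<parallel>) < e / 3"
    using \<open>e > 0\<close>
    by (intro frequently_mult_sum_less_of_summable_power2 summable_power2_seminorm_step) simp
  ultimately obtain n where "\<parallel>g\<parallel> * \<parallel>g - S\<parallel> \<le> e / 3" "\<langle>residual g t n, S\<rangle> < e / 3"
    "\<parallel>t n\<parallel> * (\<Sum>k<n. \<parallel>t k\<parallel>) < e / 3"
    using frequently_ex[OF frequently_eventually_conj] by blast
  then have "\<langle>residual g t n, residual g t n\<rangle> < e"
    using energy_residual_le[OF \<open>S \<in> V\<close>, of n] by linarith
  then show ?thesis by blast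
qed

theorem energy_residual_tendsto_0:
  assumes "\<And>\<epsilon>. \<epsilon> > 0 \<Longrightarrow> \<exists>S\<in>span \<D>. \<parallel>g - S\<parallel> \<le> \<epsilon>"
  shows "(\<lambda>n. \<langle>residual g t n, residual g t n\<rangle>) \<longlonglongrightarrow> 0"
  using decseq_energy_residual form_nonneg[OF residual_mem] energy_residual_less_exists[OF assms]
  by (rule decseq_tendsto_0)

end

subsection \<open>Square integrable functions\<close>

definition sq_integrable :: "'a measure \<Rightarrow> ('a \<Rightarrow> 'b::euclidean_space) \<Rightarrow> bool" where
  "sq_integrable M F \<longleftrightarrow> F \<in> borel_measurable M \<and> integrable M (\<lambda>x. (norm (F x))\<^sup>2)"

definition L2_inner :: "'a measure \<Rightarrow> ('a \<Rightarrow> 'b::euclidean_space) \<Rightarrow> ('a \<Rightarrow> 'b) \<Rightarrow> real" where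
  "L2_inner M F G = (\<integral>x. F x \<bullet> G x \<partial>M)"

abbreviation L2_norm :: "'a measure \<Rightarrow> ('a \<Rightarrow> 'b::euclidean_space) \<Rightarrow> real" where
  "L2_norm M \<equiv> form_norm (L2_inner M)"

lemma L2_norm_eq: "L2_norm M F = sqrt (\<integral>x. (norm (F x))\<^sup>2 \<partial>M)"
  by (simp add: form_norm_def L2_inner_def power2_norm_eq_inner)

lemma L2_norm_tendsto_0_iff:
  "(\<lambda>n. L2_norm M (F n)) \<longlonglongrightarrow> 0 \<longleftrightarrow> (\<lambda>n. \<integral>x. (norm (F n x))\<^sup>2 \<partial>M) \<longlonglongrightarrow> 0"
proof
  assume "(\<lambda>n. L2_norm M (F n)) \<longlonglongrightarrow> 0"
  then show "(\<lambda>n. \<integral>x. (norm (F n x))\<^sup>2 \<partial>M) \<longlonglongrightarrow> 0"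
    using tendsto_power[of "\<lambda>n. L2_norm M (F n)" 0 sequentially 2] by (simp add: L2_norm_eq)
next
  assume "(\<lambda>n. \<integral>x. (norm (F n x))\<^sup>2 \<partial>M) \<longlonglongrightarrow> 0"
  then show "(\<lambda>n. L2_norm M (F n)) \<longlonglongrightarrow> 0"
    unfolding L2_norm_eq by (metis real_sqrt_zero tendsto_real_sqrt)
qed

lemma L2_inner_commute: "L2_inner M F G = L2_inner M G F"
  by (simp add: L2_inner_def inner_commute)

lemma sq_integrable_imp_measurable: "sq_integrable M F \<Longrightarrow> F \<in> borel_measurable M"
  and sq_integrable_imp_integrable: "sq_integrable M F \<Longrightarrow> integrable M (\<lambda>x. (norm (F x))\<^sup>2)"
  by (simp_all add: sq_integrable_def)

lemma integrable_inner_of_sq_integrable: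
  assumes "sq_integrable M F" "sq_integrable M G"
  shows "integrable M (\<lambda>x. F x \<bullet> G x)"
proof (rule Bochner_Integration.integrable_bound)
  note [measurable] = assms[THEN sq_integrable_imp_measurable]
  show "integrable M (\<lambda>x. (norm (F x))\<^sup>2 + (norm (G x))\<^sup>2)"
    using assms by (simp add: sq_integrable_def)
  show "(\<lambda>x. F x \<bullet> G x) \<in> borel_measurable M" by measurable
  have "\<bar>a \<bullet> b\<bar> \<le> (norm a)\<^sup>2 + (norm b)\<^sup>2" for a b :: 'b
  proof -
    have "0 \<le> norm a * norm b" by simp
    then show ?thesis
      using Cauchy_Schwarz_ineq2[of a b] sum_squares_bound[of "norm a" "norm b"] by linarith
  qed
  then show "AE x in M. norm (F x \<bullet> G x) \<le> norm ((norm (F x))\<^sup>2 + (norm (G x))\<^sup>2)"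
    by (simp add: abs_of_nonneg)
qed

lemma subspace_sq_integrable: "subspace (Collect (sq_integrable M))"
proof (rule subspaceI)
  fix F G :: "'a \<Rightarrow> 'b"
  assume "F \<in> Collect (sq_integrable M)" "G \<in> Collect (sq_integrable M)"
  then have FG: "sq_integrable M F" "sq_integrable M G" by simp_all
  have "(norm (F x + G x))\<^sup>2 = (norm (F x))\<^sup>2 + 2 * (F x \<bullet> G x) + (norm (G x))\<^sup>2" for x
    by (simp add: power2_norm_eq_inner inner_add_left inner_add_right inner_commute)
  then show "F + G \<in> Collect (sq_integrable M)"
    using FG integrable_inner_of_sq_integrable[OF FG]
    by (simp add: sq_integrable_def plus_fun_def borel_measurable_add)
qed (auto simp: sq_integrable_def power_mult_distrib scaleR_fun_def zero_fun_def)

lemmas sq_integrable_0 = subspace_0[OF subspace_sq_integrable, unfolded mem_Collect_eq]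
  and sq_integrable_add = subspace_add[OF subspace_sq_integrable, unfolded mem_Collect_eq]
  and sq_integrable_diff = subspace_diff[OF subspace_sq_integrable, unfolded mem_Collect_eq]
  and sq_integrable_scaleR = subspace_scale[OF subspace_sq_integrable, unfolded mem_Collect_eq]
  and sq_integrable_sum = subspace_sum[OF subspace_sq_integrable, unfolded mem_Collect_eq]

interpretation L2: semi_inner_product "Collect (sq_integrable M)" "L2_inner M" for M
  by standard
    (rule subspace_sq_integrable L2_inner_commute
      | simp add: L2_inner_def inner_add_left integrable_inner_of_sq_integrable)+

lemma L2_norm_le_of_bounded:
  assumes M: "finite_measure M" and F: "sq_integrable M F" and bound: "\<And>x. norm (F x) \<le> C"
  shows "L2_norm M F \<le> sqrt (measure M (space M)) * C"
proof -
  interpret finite_measure M by (fact M)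
  have "0 \<le> C"
    using bound norm_ge_zero order_trans by blast
  have "(\<integral>x. (norm (F x))\<^sup>2 \<partial>M) \<le> (\<integral>x. C\<^sup>2 \<partial>M)"
    using F bound by (intro integral_mono) (auto simp: sq_integrable_def intro: power_mono)
  then have "L2_norm M F \<le> sqrt (measure M (space M) * C\<^sup>2)"
    unfolding L2_norm_eq by (simp add: real_sqrt_le_mono)
  then show ?thesis
    using \<open>0 \<le> C\<close> by (simp add: real_sqrt_mult)
qed

lemma sq_integrable_scaleR_const:
  fixes u :: "'a \<Rightarrow> real"
  assumes "sq_integrable M u"
  shows "sq_integrable M (\<lambda>x. u x *\<^sub>R c)"
  using assms by (auto simp: sq_integrable_def power_mult_distrib)

lemma sq_integrable_Pair:
  fixes u v :: "'a \<Rightarrow> real"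
  assumes "sq_integrable M u" "sq_integrable M v"
  shows "sq_integrable M (\<lambda>x. (u x, v x))"
  using assms by (auto simp: sq_integrable_def norm_Pair)

lemma L2_iff_sq_integrable: "u \<in> L2 U \<longleftrightarrow> sq_integrable (lebesgue_on U) u"
  by (simp add: L2_def sq_integrable_def)

lemma L2vec_iff_sq_integrable: "G \<in> L2vec U \<longleftrightarrow> sq_integrable (lebesgue_on U) G"
  by (simp add: L2vec_def sq_integrable_def)

subsection \<open>Directional derivatives and smooth functions\<close>

abbreviation dir_deriv :: "'a::real_normed_vector \<Rightarrow> ('a \<Rightarrow> real) \<Rightarrow> 'a \<Rightarrow> real" where
  "dir_deriv i h \<equiv> \<lambda>x. frechet_derivative h (at x) i"

lemma dir_derivI:
  "(\<And>x. (h has_derivative h' x) (at x)) \<Longrightarrow> dir_deriv i h = (\<lambda>x. h' x i)"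
  using frechet_derivative_at by (metis (no_types, lifting))

lemma
  assumes "\<And>x. f differentiable (at x)" "\<And>x. g differentiable (at x)"
  shows dir_deriv_add: "dir_deriv i (f + g) = dir_deriv i f + dir_deriv i g"
    and dir_deriv_mult: "dir_deriv i (f * g) = f * dir_deriv i g + dir_deriv i f * g"
proof -
  have f: "(f has_derivative frechet_derivative f (at x)) (at x)"
    and g: "(g has_derivative frechet_derivative g (at x)) (at x)" for x
    using assms by (simp_all flip: frechet_derivative_works)
  show "dir_deriv i (f + g) = dir_deriv i f + dir_deriv i g"
    unfolding plus_fun_def by (rule dir_derivI) (intro has_derivative_add f g)
  show "dir_deriv i (f * g) = f * dir_deriv i g + dir_deriv i f * g"
    unfolding plus_fun_def times_fun_def by (rule dir_derivI) (intro has_derivative_mult f g)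
qed

lemma dir_deriv_scaleR:
  assumes "\<And>x. h differentiable (at x)"
  shows "dir_deriv i (c *\<^sub>R h) = c *\<^sub>R dir_deriv i h"
  using assms unfolding scaleR_fun_def
  by (intro dir_derivI has_derivative_scaleR_right) (simp flip: frechet_derivative_works)

lemma dir_deriv_diff:
  assumes "\<And>x. f differentiable (at x)" "\<And>x. g differentiable (at x)"
  shows "dir_deriv i (f - g) = dir_deriv i f - dir_deriv i g"
  using assms unfolding fun_diff_def
  by (intro dir_derivI has_derivative_diff) (simp_all flip: frechet_derivative_works)

lemma differentiable_line_has_real_derivative:
  fixes h :: "'a::real_normed_vector \<Rightarrow> real"
  assumes "h differentiable (at (x + t *\<^sub>R i))"
  shows "((\<lambda>t. h (x + t *\<^sub>R i)) has_real_derivative dir_deriv i h (x + t *\<^sub>R i)) (at t)"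
proof -
  let ?D = "frechet_derivative h (at (x + t *\<^sub>R i))"
  have "((\<lambda>t. x + t *\<^sub>R i) has_derivative (\<lambda>s. s *\<^sub>R i)) (at t)"
    by (auto intro!: derivative_eq_intros)
  moreover have "(h has_derivative ?D) (at (x + t *\<^sub>R i))"
    using assms by (simp flip: frechet_derivative_works)
  ultimately have "((\<lambda>t. h (x + t *\<^sub>R i)) has_derivative (\<lambda>s. ?D (s *\<^sub>R i))) (at t)"
    by (rule has_derivative_compose)
  also have "(\<lambda>s. ?D (s *\<^sub>R i)) = (*) (?D i)"
    using linear_scale[OF linear_frechet_derivative[OF assms]] by (simp add: fun_eq_iff)
  finally show ?thesis by (simp add: has_field_derivative_def)
qed

lemma dir_deriv_real_eqI:
  "(\<And>x. (h has_real_derivative h' x) (at x)) \<Longrightarrow> dir_deriv 1 h = h'"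
  using dir_derivI[of h "\<lambda>x. (*) (h' x)" 1] by (simp add: has_field_derivative_def)

lemma dir_deriv_zero_outside:
  assumes "compact K" "\<And>x. x \<notin> K \<Longrightarrow> h x = 0" "x \<notin> K"
  shows "dir_deriv i h x = 0"
proof -
  have "(h has_derivative (\<lambda>_. 0)) (at x)"
  proof (rule has_derivative_transform_within_open)
    show "((\<lambda>_. 0) has_derivative (\<lambda>_. 0)) (at x)" by simp
    show "open (- K)" using assms(1) by (simp add: compact_imp_closed open_Compl)
  qed (use assms in auto)
  then show ?thesis using frechet_derivative_at by metis
qed

lemma smooth_fun_differentiable: "smooth_fun h \<Longrightarrow> h differentiable (at x)"
  and smooth_fun_continuous_on: "smooth_fun h \<Longrightarrow> continuous_on A h"
  and smooth_fun_dir_deriv: "smooth_fun h \<Longrightarrow> i \<in> Basis \<Longrightarrow> smooth_fun (dir_deriv i h)"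
  unfolding smooth_fun_def by (blast intro: continuous_on_subset)+

lemma span_subset_smooth_fun:
  assumes diff: "\<And>h x. h \<in> S \<Longrightarrow> h differentiable (at x)"
    and deriv: "\<And>h i. h \<in> S \<Longrightarrow> i \<in> Basis \<Longrightarrow> dir_deriv i h \<in> span S"
  shows "span S \<subseteq> Collect smooth_fun"
proof -
  let ?D = "{h. (\<forall>x. h differentiable (at x)) \<and> (\<forall>i\<in>Basis. dir_deriv i h \<in> span S)}"
  have closed: "span S \<subseteq> ?D"
  proof (rule span_minimal)
    show "S \<subseteq> ?D"
      by (intro subsetI CollectI conjI allI ballI diff deriv)
    show "subspace ?D"
    proof (rule subspaceI)
      show "0 \<in> ?D"
        by (simp add: zero_fun_def span_zero_fun)
    next
      fix f g assume "f \<in> ?D" "g \<in> ?D"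
      moreover from this have "(f + g) differentiable (at x)" for x
        unfolding plus_fun_def by (auto intro: differentiable_add)
      ultimately show "f + g \<in> ?D"
        by (simp add: dir_deriv_add span_add)
    next
      fix c f assume "f \<in> ?D"
      moreover from this have "(c *\<^sub>R f) differentiable (at x)" for x
        unfolding scaleR_fun_def by (auto intro: differentiable_scaleR)
      ultimately show "c *\<^sub>R f \<in> ?D"
        by (simp add: dir_deriv_scaleR span_scale)
    qed
  qed
  have "continuous_on UNIV h" if "h \<in> span S" for h
    using subsetD[OF closed that]
    by (auto intro!: continuous_at_imp_continuous_on differentiable_imp_continuous_within)
  then have "smooth_fun h" if "h \<in> span S" for h
    unfolding smooth_fun_def using that closed by (intro exI[of _ "span S"]) auto
  then show ?thesis by blast
qed

lemma subspace_smooth_fun: "subspace (Collect smooth_fun)"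
proof -
  have "span (Collect smooth_fun) \<subseteq> Collect smooth_fun"
    by (rule span_subset_smooth_fun)
      (simp_all add: smooth_fun_differentiable span_base smooth_fun_dir_deriv)
  then have "span (Collect smooth_fun) = Collect smooth_fun"
    using span_superset by (rule subset_antisym)
  then show ?thesis by (simp only: span_eq_iff)
qed

lemma smooth_fun_const: "smooth_fun (\<lambda>_. c)"
proof -
  have "span {\<lambda>_::'a. c} \<subseteq> Collect smooth_fun"
    by (rule span_subset_smooth_fun) (auto simp: span_zero_fun)
  then show ?thesis by (auto intro: span_base)
qed

lemmas smooth_fun_add = subspace_add[OF subspace_smooth_fun, unfolded mem_Collect_eq]
  and smooth_fun_diff = subspace_diff[OF subspace_smooth_fun, unfolded mem_Collect_eq]
  and smooth_fun_scaleR = subspace_scale[OF subspace_smooth_fun, unfolded mem_Collect_eq]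

lemma smooth_fun_mult:
  assumes "smooth_fun f" "smooth_fun g"
  shows "smooth_fun (f * g)"
proof -
  let ?S = "{f * g | f g :: 'a \<Rightarrow> real. smooth_fun f \<and> smooth_fun g}"
  have "span ?S \<subseteq> Collect smooth_fun"
  proof (rule span_subset_smooth_fun)
    fix h assume "h \<in> ?S"
    then obtain f g where h: "h = f * g" and fg: "smooth_fun f" "smooth_fun g" by blast
    note diff = fg[THEN smooth_fun_differentiable]
    show "h differentiable (at x)" for x
      unfolding h times_fun_def by (intro differentiable_mult diff)
    show "dir_deriv i h \<in> span ?S" if "i \<in> Basis" for i
      unfolding h dir_deriv_mult[OF diff]
      using fg that by (intro span_add span_base) (blast intro: smooth_fun_dir_deriv)+
  qed
  then show ?thesis
    using assms by (blast intro: span_base)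
qed

lemma cgrad_add:
  "smooth_fun f \<Longrightarrow> smooth_fun g \<Longrightarrow> cgrad (f + g) = cgrad f + cgrad g"
  by (simp add: cgrad_def fun_eq_iff smooth_fun_differentiable fun_cong[OF dir_deriv_add]
      scaleR_add_left sum.distrib)

lemma cgrad_scaleR: "smooth_fun f \<Longrightarrow> cgrad (c *\<^sub>R f) = c *\<^sub>R cgrad f"
  by (simp add: cgrad_def fun_eq_iff smooth_fun_differentiable fun_cong[OF dir_deriv_scaleR]
      scaleR_sum_right)

lemma cgrad_mult:
  "smooth_fun f \<Longrightarrow> smooth_fun g \<Longrightarrow> cgrad (f * g) x = f x *\<^sub>R cgrad g x + g x *\<^sub>R cgrad f x"
  by (simp add: cgrad_def smooth_fun_differentiable fun_cong[OF dir_deriv_mult]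
      scaleR_add_left sum.distrib scaleR_sum_right mult.commute)

lemma cgrad_inner_cgrad:
  "cgrad f x \<bullet> cgrad g x = (\<Sum>i\<in>Basis. dir_deriv i f x * dir_deriv i g x)"
  by (subst euclidean_inner) (simp add: cgrad_def)

lemma cgrad_real: "cgrad h = dir_deriv 1 h"
  by (simp add: cgrad_def fun_eq_iff)

lemma continuous_on_cgrad: "smooth_fun h \<Longrightarrow> continuous_on A (cgrad h)"
  unfolding cgrad_def
  by (intro continuous_on_sum continuous_on_scaleR continuous_on_const smooth_fun_continuous_on
      smooth_fun_dir_deriv)

definition C1_size :: "('a::euclidean_space \<Rightarrow> real) \<Rightarrow> 'a \<Rightarrow> real" where
  "C1_size h x = \<bar>h x\<bar> + norm (cgrad h x)"

lemma norm_cgrad_mult_le: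
  assumes "smooth_fun f" "smooth_fun g"
  shows "norm (cgrad (f * g) x) \<le> C1_size f x * C1_size g x"
proof -
  have "norm (cgrad (f * g) x) \<le> \<bar>f x\<bar> * norm (cgrad g x) + \<bar>g x\<bar> * norm (cgrad f x)"
    using norm_triangle_ineq[of "f x *\<^sub>R cgrad g x" "g x *\<^sub>R cgrad f x"]
    by (simp add: cgrad_mult[OF assms])
  also have "\<dots> \<le> C1_size f x * C1_size g x"
    by (simp add: C1_size_def algebra_simps)
  finally show ?thesis .
qed

definition laplacian :: "('a::euclidean_space \<Rightarrow> real) \<Rightarrow> 'a \<Rightarrow> real" where
  "laplacian h = (\<Sum>i\<in>Basis. dir_deriv i (dir_deriv i h))"

subsection \<open>Smooth functions of one variable\<close>

lemma smooth_fun_has_real_derivative: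
  fixes h :: "real \<Rightarrow> real"
  shows "smooth_fun h \<Longrightarrow> (h has_real_derivative dir_deriv 1 h x) (at x)"
  using differentiable_line_has_real_derivative[of h 0 x 1] by (simp add: smooth_fun_differentiable)

lemma real_span_subset_smooth_fun:
  fixes S :: "(real \<Rightarrow> real) set"
  assumes "\<And>h. h \<in> S \<Longrightarrow> \<exists>h'\<in>span S. \<forall>x. (h has_real_derivative h' x) (at x)"
  shows "span S \<subseteq> Collect smooth_fun"
proof (rule span_subset_smooth_fun)
  fix h assume "h \<in> S"
  then obtain h' where h': "h' \<in> span S" "\<And>x. (h has_real_derivative h' x) (at x)"
    using assms by blast
  show "h differentiable (at x)" for x
    using h'(2) by (auto simp: has_field_derivative_def differentiable_def)
  show "dir_deriv i h \<in> span S" if "i \<in> Basis" for i :: real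
    using that h'(1) dir_deriv_real_eqI[OF h'(2)] by simp
qed

lemma smooth_fun_compose_affine:
  fixes h :: "real \<Rightarrow> real"
  assumes "smooth_fun h"
  shows "smooth_fun (\<lambda>x. h (a * x + b))"
proof -
  let ?S = "{\<lambda>x. h (a * x + b) | h :: real \<Rightarrow> real. smooth_fun h}"
  have "span ?S \<subseteq> Collect smooth_fun"
  proof (rule real_span_subset_smooth_fun)
    fix k assume "k \<in> ?S"
    then obtain h where h: "smooth_fun h" "k = (\<lambda>x. h (a * x + b))" by blast
    have "(k has_real_derivative (a *\<^sub>R (\<lambda>x. dir_deriv 1 h (a * x + b))) x) (at x)" for x
    proof -
      have "((\<lambda>x. a * x + b) has_real_derivative a) (at x)"
        by (auto intro!: derivative_eq_intros)
      from DERIV_chain2[OF smooth_fun_has_real_derivative[OF h(1)] this] show ?thesis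
        by (simp add: h(2) mult.commute)
    qed
    moreover have "a *\<^sub>R (\<lambda>x. dir_deriv 1 h (a * x + b)) \<in> span ?S"
      using smooth_fun_dir_deriv[OF h(1), of 1] by (intro span_scale span_base) auto
    ultimately show "\<exists>k'\<in>span ?S. \<forall>x. (k has_real_derivative k' x) (at x)" by blast
  qed
  then show ?thesis
    using assms by (blast intro: span_base)
qed

lemma smooth_fun_if_derivative_smooth:
  fixes F :: "real \<Rightarrow> real"
  assumes "\<And>x. (F has_real_derivative f x) (at x)" and "smooth_fun f"
  shows "smooth_fun F"
proof -
  have "span (insert F (Collect smooth_fun)) \<subseteq> Collect smooth_fun"
  proof (rule real_span_subset_smooth_fun)
    fix h assume "h \<in> insert F (Collect smooth_fun)"
    then have "\<exists>h'. smooth_fun h' \<and> (\<forall>x. (h has_real_derivative h' x) (at x))"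
      using assms smooth_fun_has_real_derivative smooth_fun_dir_deriv[of h 1] by auto
    then show "\<exists>h'\<in>span (insert F (Collect smooth_fun)). \<forall>x. (h has_real_derivative h' x) (at x)"
      by (blast intro: span_base)
  qed
  then show ?thesis by (auto intro: span_base)
qed

lemma smooth_antiderivative_exists:
  fixes f :: "real \<Rightarrow> real"
  assumes "smooth_fun f"
  obtains F where "smooth_fun F" "F a = 0" "\<And>x. (F has_real_derivative f x) (at x)"
proof -
  have "\<exists>F. \<forall>x::real. ereal x > -\<infinity> \<longrightarrow> ereal x < \<infinity> \<longrightarrow> (F has_vector_derivative f x) (at x)"
    using smooth_fun_continuous_on[OF assms, of UNIV]
    by (intro einterval_antiderivative) (auto simp: continuous_on_eq_continuous_at)
  then obtain F where "\<And>x. (F has_real_derivative f x) (at x)"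
    by (auto simp: has_real_derivative_iff_has_vector_derivative)
  then have deriv: "((\<lambda>x. F x - F a) has_real_derivative f x) (at x)" for x
    by (auto intro!: derivative_eq_intros)
  then have "smooth_fun (\<lambda>x. F x - F a)"
    using assms by (rule smooth_fun_if_derivative_smooth)
  with deriv show ?thesis
    by (intro that[of "\<lambda>x. F x - F a"]) simp_all
qed

definition exp_inv_poly :: "real poly \<Rightarrow> real \<Rightarrow> real" where
  "exp_inv_poly p x = (if x > 0 then poly p (inverse x) * exp (- inverse x) else 0)"

lemma poly_mult_exp_minus_tendsto_0:
  "((\<lambda>t::real. t ^ k * poly p t * exp (- t)) \<longlongrightarrow> 0) at_top"
proof (induction p arbitrary: k)
  case (pCons a p)
  have "((\<lambda>t::real. a * (t ^ k / exp t) + t ^ Suc k * poly p t * exp (- t)) \<longlongrightarrow> a * 0 + 0) at_top"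
    by (intro tendsto_intros tendsto_power_div_exp_0 pCons.IH)
  then show ?case by (simp add: algebra_simps exp_minus divide_inverse)
qed simp

lemma exp_inv_poly_has_real_derivative_0: "(exp_inv_poly p has_real_derivative 0) (at 0)"
proof -
  let ?q = "\<lambda>t. (exp_inv_poly p t - exp_inv_poly p 0) / (t - 0)"
  have "((\<lambda>t. inverse t ^ 1 * poly p (inverse t) * exp (- inverse t)) \<longlongrightarrow> 0) (at_right (0::real))"
    by (rule filterlim_compose[OF poly_mult_exp_minus_tendsto_0 filterlim_inverse_at_top_right])
  then have "(?q \<longlongrightarrow> 0) (at_right 0)"
    by (rule Lim_transform_eventually)
      (auto simp: eventually_at_right_field exp_inv_poly_def divide_inverse intro!: exI[of _ 1])
  moreover have "(?q \<longlongrightarrow> 0) (at_left 0)"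
    by (rule Lim_transform_eventually[OF tendsto_const])
      (auto simp: eventually_at_left_field exp_inv_poly_def intro!: exI[of _ "-1"])
  ultimately show ?thesis
    by (simp add: has_field_derivative_iff filterlim_at_split)
qed

lemma exp_inv_poly_has_real_derivative:
  "(exp_inv_poly p has_real_derivative exp_inv_poly ([:0, 0, 1:] * (p - pderiv p)) x) (at x)"
proof (cases x "0::real" rule: linorder_cases)
  case less
  have "((\<lambda>_. 0) has_real_derivative 0) (at x)" by simp
  then have "(exp_inv_poly p has_real_derivative 0) (at x)"
    by (rule has_field_derivative_transform_within_open[where S = "{..<0}"])
      (use less in \<open>auto simp: exp_inv_poly_def\<close>)
  then show ?thesis using less by (simp add: exp_inv_poly_def)
next
  case greater
  have "((\<lambda>x. poly p (inverse x) * exp (- inverse x)) has_real_derivative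
     poly ([:0, 0, 1:] * (p - pderiv p)) (inverse x) * exp (- inverse x)) (at x)"
    using greater
    by (auto intro!: derivative_eq_intros DERIV_chain2[OF poly_DERIV]
        simp: algebra_simps power2_eq_square)
  then have "(exp_inv_poly p has_real_derivative
     poly ([:0, 0, 1:] * (p - pderiv p)) (inverse x) * exp (- inverse x)) (at x)"
    by (rule has_field_derivative_transform_within_open[where S = "{0<..}"])
      (use greater in \<open>auto simp: exp_inv_poly_def\<close>)
  then show ?thesis using greater by (simp add: exp_inv_poly_def)
next
  case equal
  then show ?thesis
    using exp_inv_poly_has_real_derivative_0 by (simp add: exp_inv_poly_def)
qed

lemma smooth_fun_exp_inv_poly: "smooth_fun (exp_inv_poly p)"
proof -
  have "span (range exp_inv_poly) \<subseteq> Collect smooth_fun"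
    using exp_inv_poly_has_real_derivative
    by (intro real_span_subset_smooth_fun) (blast intro: span_base)
  then show ?thesis by (auto intro: span_base)
qed

lemma smooth_step_exists:
  obtains K :: "real \<Rightarrow> real"
  where "smooth_fun K" "\<And>x. x \<le> 0 \<Longrightarrow> K x = 0" "\<And>x. x \<ge> 1 \<Longrightarrow> K x = 1"
proof -
  define b where "b = exp_inv_poly 1 * (\<lambda>x. exp_inv_poly 1 (- 1 * x + 1))"
  have b_pos: "b x > 0" if "0 < x" "x < 1" for x
    using that by (simp add: b_def exp_inv_poly_def)
  have b_zero: "b x = 0" if "x \<le> 0 \<or> 1 \<le> x" for x
    using that by (auto simp: b_def exp_inv_poly_def)
  have "smooth_fun b"
    unfolding b_def by (intro smooth_fun_mult smooth_fun_compose_affine smooth_fun_exp_inv_poly)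
  then obtain F where F: "smooth_fun F" "F 0 = 0" "\<And>x. (F has_real_derivative b x) (at x)"
    using smooth_antiderivative_exists by blast
  have F_const: "F x = F y" if "convex I" "x \<in> I" "y \<in> I" "\<And>z. z \<in> I \<Longrightarrow> b z = 0" for I x y
    using has_field_derivative_zero_constant[OF \<open>convex I\<close>, of F] that
      F(3)[THEN has_field_derivative_at_within] by (metis (full_types))
  have "F 0 < F 1"
    using b_pos F(3) by (intro DERIV_pos_imp_increasing_open[where f = F])
      (auto intro: DERIV_isCont continuous_at_imp_continuous_on)
  then have "F 1 \<noteq> 0" using F(2) by simp
  show thesis
  proof (rule that[of "(1 / F 1) *\<^sub>R F"])
    show "smooth_fun ((1 / F 1) *\<^sub>R F)" by (intro smooth_fun_scaleR F(1))
    show "((1 / F 1) *\<^sub>R F) x = 0" if "x \<le> 0" for x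
      using F_const[of "{..0}" x 0] that b_zero F(2) by simp
    show "((1 / F 1) *\<^sub>R F) x = 1" if "x \<ge> 1" for x
      using F_const[of "{1..}" x 1] that b_zero \<open>F 1 \<noteq> 0\<close> by simp
  qed
qed

lemma smooth_cutoff_exists:
  fixes \<alpha> \<beta> \<delta> :: real
  assumes "\<delta> > 0"
  obtains \<eta> where "smooth_fun \<eta>" "\<And>x. x \<in> {\<alpha>..\<beta>} \<Longrightarrow> \<eta> x = 1" "\<And>x. x \<notin> {\<alpha> - \<delta>..\<beta> + \<delta>} \<Longrightarrow> \<eta> x = 0"
proof -
  obtain K :: "real \<Rightarrow> real"
    where K: "smooth_fun K" "\<And>x. x \<le> 0 \<Longrightarrow> K x = 0" "\<And>x. x \<ge> 1 \<Longrightarrow> K x = 1"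
    using smooth_step_exists by blast
  define a where "a = 1 / \<delta>"
  have a: "a > 0" "a * \<delta> = 1"
    using assms by (simp_all add: a_def)
  let ?left = "\<lambda>x. K (a * x + (1 - a * \<alpha>))" and ?right = "\<lambda>x. K ((- a) * x + (1 + a * \<beta>))"
  show thesis
  proof (rule that[of "?left * ?right"])
    show "smooth_fun (?left * ?right)"
      by (intro smooth_fun_mult smooth_fun_compose_affine K)
    show "(?left * ?right) x = 1" if "x \<in> {\<alpha>..\<beta>}" for x
      using that a(1) by (simp add: K(3))
    show "(?left * ?right) x = 0" if outside: "x \<notin> {\<alpha> - \<delta>..\<beta> + \<delta>}" for x
    proof -
      consider (left) "x \<le> \<alpha> - \<delta>" | (right) "\<beta> + \<delta> \<le> x" using outside by fastforce
      then show ?thesis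
      proof cases
        case left
        then have "a * x \<le> a * (\<alpha> - \<delta>)" using a(1) by simp
        then show ?thesis using a(2) by (simp add: K(2) right_diff_distrib)
      next
        case right
        then have "a * (\<beta> + \<delta>) \<le> a * x" using a(1) by simp
        then show ?thesis using a(2) by (simp add: K(2) distrib_left)
      qed
    qed
  qed
qed

subsection \<open>Test functions\<close>

lemma test_funI:
  assumes "smooth_fun \<phi>" "compact K" "K \<subseteq> U" "\<And>x. x \<notin> K \<Longrightarrow> \<phi> x = 0"
  shows "test_fun U \<phi>"
proof -
  have "closure {x. \<phi> x \<noteq> 0} \<subseteq> K"
    using assms by (intro closure_minimal) (auto simp: compact_imp_closed)
  moreover from this have "compact (closure {x. \<phi> x \<noteq> 0})"
    using assms(2) compact_Int_closed[of K "closure {x. \<phi> x \<noteq> 0}"] by (simp add: inf_absorb2)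
  ultimately show ?thesis using assms by (auto simp: test_fun_def)
qed

lemma test_funE:
  assumes "test_fun U \<phi>"
  obtains K where "compact K" "K \<subseteq> U" "\<And>x. x \<notin> K \<Longrightarrow> \<phi> x = 0"
proof (rule that[of "closure {x. \<phi> x \<noteq> 0}"])
  show "\<phi> x = 0" if "x \<notin> closure {x. \<phi> x \<noteq> 0}" for x
    using that closure_subset[THEN subsetD, of x "{x. \<phi> x \<noteq> 0}"] by auto
qed (use assms in \<open>auto simp: test_fun_def\<close>)

lemma test_fun_smooth: "test_fun U \<phi> \<Longrightarrow> smooth_fun \<phi>"
  by (simp add: test_fun_def)

lemma subspace_test_fun: "subspace (Collect (test_fun U))"
proof (rule subspaceI)
  show "0 \<in> Collect (test_fun U)"
    using smooth_fun_const[of 0] by (auto intro: test_funI[of _ "{}"] simp: zero_fun_def)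
next
  fix \<phi> \<psi> assume "\<phi> \<in> Collect (test_fun U)" "\<psi> \<in> Collect (test_fun U)"
  then have tests: "test_fun U \<phi>" "test_fun U \<psi>" by simp_all
  obtain K where K: "compact K" "K \<subseteq> U" "\<And>x. x \<notin> K \<Longrightarrow> \<phi> x = 0"
    using test_funE[OF tests(1)] by blast
  obtain L where L: "compact L" "L \<subseteq> U" "\<And>x. x \<notin> L \<Longrightarrow> \<psi> x = 0"
    using test_funE[OF tests(2)] by blast
  have "test_fun U (\<phi> + \<psi>)"
    by (rule test_funI[of _ "K \<union> L"])
      (use K L tests in \<open>auto intro: smooth_fun_add test_fun_smooth\<close>)
  then show "\<phi> + \<psi> \<in> Collect (test_fun U)" by simp
next
  fix c \<phi> assume "\<phi> \<in> Collect (test_fun U)"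
  then have test: "test_fun U \<phi>" by simp
  then obtain K where "compact K" "K \<subseteq> U" "\<And>x. x \<notin> K \<Longrightarrow> \<phi> x = 0"
    using test_funE by blast
  then have "test_fun U (c *\<^sub>R \<phi>)"
    by (intro test_funI[of _ K] smooth_fun_scaleR test_fun_smooth[OF test]) simp_all
  then show "c *\<^sub>R \<phi> \<in> Collect (test_fun U)" by simp
qed

lemmas test_fun_add = subspace_add[OF subspace_test_fun, unfolded mem_Collect_eq]
  and test_fun_diff = subspace_diff[OF subspace_test_fun, unfolded mem_Collect_eq]
  and test_fun_scaleR = subspace_scale[OF subspace_test_fun, unfolded mem_Collect_eq]
  and test_fun_sum = subspace_sum[OF subspace_test_fun, unfolded mem_Collect_eq]

lemma test_fun_mult:
  assumes "test_fun U \<phi>" "smooth_fun h"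
  shows "test_fun U (\<phi> * h)"
proof -
  obtain K where "compact K" "K \<subseteq> U" "\<And>x. x \<notin> K \<Longrightarrow> \<phi> x = 0"
    using assms(1) by (rule test_funE) blast
  then show ?thesis
    by (intro test_funI[of _ K] smooth_fun_mult test_fun_smooth[OF assms(1)] assms(2)) simp_all
qed

lemma test_fun_dir_deriv:
  assumes "test_fun U \<phi>" "i \<in> Basis"
  shows "test_fun U (dir_deriv i \<phi>)"
proof -
  obtain K where "compact K" "K \<subseteq> U" "\<And>x. x \<notin> K \<Longrightarrow> \<phi> x = 0"
    using assms(1) by (rule test_funE) blast
  then show ?thesis
    by (intro test_funI[of _ K] smooth_fun_dir_deriv test_fun_smooth[OF assms(1)] assms(2)
        dir_deriv_zero_outside[of K \<phi>])
qed

lemma test_fun_laplacian: "test_fun U \<phi> \<Longrightarrow> test_fun U (laplacian \<phi>)"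
  unfolding laplacian_def by (intro test_fun_sum test_fun_dir_deriv)

lemma test_fun_C1_size_bounded:
  assumes "test_fun U \<phi>"
  obtains C where "C > 0" "\<And>x. C1_size \<phi> x \<le> C"
proof -
  obtain K where K: "compact K" "\<And>x. x \<notin> K \<Longrightarrow> \<phi> x = 0"
    using assms by (rule test_funE) blast
  have "bounded (C1_size \<phi> ` K)"
    unfolding C1_size_def using assms K(1)
    by (intro compact_imp_bounded compact_continuous_image continuous_intros
        smooth_fun_continuous_on continuous_on_cgrad test_fun_smooth)
  then obtain C where C: "C > 0" "\<And>x. x \<in> K \<Longrightarrow> C1_size \<phi> x \<le> C"
    by (force simp: bounded_pos)
  moreover have "C1_size \<phi> x \<le> C" if "x \<notin> K" for x
    using that C(1) K dir_deriv_zero_outside[OF K that] by (simp add: C1_size_def cgrad_def)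
  ultimately show ?thesis using that by blast
qed

subsection \<open>Integration by parts\<close>

lemma integrable_lborel_compact_support:
  fixes h :: "'a::euclidean_space \<Rightarrow> real"
  assumes "continuous_on UNIV h" "compact K" "\<And>x. x \<notin> K \<Longrightarrow> h x = 0"
  shows "integrable lborel h"
proof -
  have "integrable lborel (\<lambda>x. indicator K x *\<^sub>R h x)"
    using assms by (intro borel_integrable_compact) (auto intro: continuous_on_subset)
  moreover have "(\<lambda>x. indicator K x *\<^sub>R h x) = h"
    using assms(3) by (force simp: indicator_def)
  ultimately show ?thesis by simp
qed

lemma has_bochner_integral_lborel_translation:
  fixes f :: "'a::euclidean_space \<Rightarrow> real"
  assumes "has_bochner_integral lborel f I"
  shows "has_bochner_integral lborel (\<lambda>x. f (c + x)) I"
proof -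
  have f: "f \<in> borel_measurable borel"
    using borel_measurable_has_bochner_integral[OF assms] by simp
  have translation: "(+) c \<in> lborel \<rightarrow>\<^sub>M borel"
    by measurable
  show ?thesis
    using assms integrable_distr_eq[OF translation f] integral_distr[OF translation f]
    by (simp add: has_bochner_integral_iff lborel_distr_plus)
qed

lemma integrable_lborel_pair_translates:
  fixes f :: "'a::euclidean_space \<Rightarrow> real"
  assumes cont: "continuous_on UNIV f" and K: "compact K" "\<And>x. x \<notin> K \<Longrightarrow> f x = 0"
  shows "integrable (lborel \<Otimes>\<^sub>M lborel) (\<lambda>(x, t). indicator {0..1::real} t *\<^sub>R f (t *\<^sub>R v + x))"
proof -
  let ?Q = "(\<lambda>(y, t). (y - t *\<^sub>R v, t)) ` (K \<times> {0..1::real})"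
  have "integrable lborel (\<lambda>z. indicator ?Q z *\<^sub>R f (snd z *\<^sub>R v + fst z))"
    using K(1)
    by (intro borel_integrable_compact compact_continuous_image compact_Times compact_Icc
        continuous_on_compose2[OF cont]) (auto intro!: continuous_intros simp: case_prod_beta')
  also have "(\<lambda>z. indicator ?Q z *\<^sub>R f (snd z *\<^sub>R v + fst z))
      = (\<lambda>(x, t). indicator {0..1::real} t *\<^sub>R f (t *\<^sub>R v + x))"
  proof (intro ext, clarify)
    fix x :: 'a and t :: real
    have "(x, t) \<in> ?Q \<longleftrightarrow> t *\<^sub>R v + x \<in> K \<and> t \<in> {0..1}"
      by (force simp: image_iff)
    then show "indicator ?Q (x, t) *\<^sub>R f (snd (x, t) *\<^sub>R v + fst (x, t))
        = indicator {0..1} t *\<^sub>R f (t *\<^sub>R v + x)"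
      using K(2)[of "t *\<^sub>R v + x"] by (auto simp: indicator_def)
  qed
  finally show ?thesis by (simp add: lborel_prod)
qed

lemma integral_dir_deriv_segment:
  fixes h :: "'a::real_normed_vector \<Rightarrow> real"
  assumes diff: "\<And>x. h differentiable (at x)" and cont: "continuous_on UNIV (dir_deriv i h)"
  shows "(\<integral>t. indicator {0..1::real} t *\<^sub>R dir_deriv i h (t *\<^sub>R i + x) \<partial>lborel) = h (i + x) - h x"
proof -
  have "((\<lambda>t. h (t *\<^sub>R i + x)) has_vector_derivative dir_deriv i h (t *\<^sub>R i + x))
      (at t within {0..1})" for t
    using differentiable_line_has_real_derivative[of h x t i] diff
    by (simp add: add.commute has_real_derivative_iff_has_vector_derivative
        has_vector_derivative_at_within)
  from integral_FTC_Icc[OF _ this] show ?thesis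
    by (simp add: continuous_on_compose2[OF cont] continuous_intros)
qed

text \<open>By Fubini, \<open>\<integral> \<partial>\<^sub>i h = \<integral>\<integral>\<^sub>0\<^sup>1 \<partial>\<^sub>i h (x + t i) dt dx = \<integral> (h (x + i) - h x) dx\<close>.\<close>

lemma integral_dir_deriv_eq_0:
  fixes h :: "'a::euclidean_space \<Rightarrow> real"
  assumes diff: "\<And>x. h differentiable (at x)" and cont: "continuous_on UNIV (dir_deriv i h)"
    and K: "compact K" "\<And>x. x \<notin> K \<Longrightarrow> h x = 0"
  shows "(\<integral>x. dir_deriv i h x \<partial>lborel) = 0"
proof -
  let ?f = "\<lambda>x t. indicator {0..1::real} t *\<^sub>R dir_deriv i h (t *\<^sub>R i + x)"
  have h_cont: "continuous_on UNIV h"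
    using diff by (simp add: continuous_at_imp_continuous_on differentiable_imp_continuous_within)
  have integral_h: "has_bochner_integral lborel h (\<integral>x. h x \<partial>lborel)"
    using integrable_lborel_compact_support[OF h_cont K] by (rule has_bochner_integral_integrable)
  have dh_zero: "dir_deriv i h x = 0" if "x \<notin> K" for x
    by (rule dir_deriv_zero_outside[OF K that])
  have integral_dh: "has_bochner_integral lborel (dir_deriv i h) (\<integral>x. dir_deriv i h x \<partial>lborel)"
    using integrable_lborel_compact_support[OF cont K(1) dh_zero]
    by (rule has_bochner_integral_integrable)
  have "(\<integral>x. \<integral>t. ?f x t \<partial>lborel \<partial>lborel) = (\<integral>x. h (i + x) - h x \<partial>lborel)"
    by (simp only: integral_dir_deriv_segment[OF diff cont])
  also have "\<dots> = 0"
    using has_bochner_integral_diff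
      [OF has_bochner_integral_lborel_translation[OF integral_h] integral_h]
    by (simp add: has_bochner_integral_integral_eq)
  also have "(\<integral>x. \<integral>t. ?f x t \<partial>lborel \<partial>lborel) = (\<integral>t. \<integral>x. ?f x t \<partial>lborel \<partial>lborel)"
    using integrable_lborel_pair_translates[OF cont K(1) dh_zero]
    by (rule lborel_pair.Fubini_integral[symmetric])
  also have "\<dots> = (\<integral>t. indicator {0..1::real} t *\<^sub>R (\<integral>x. dir_deriv i h x \<partial>lborel) \<partial>lborel)"
    using has_bochner_integral_lborel_translation
      [OF integral_dh, THEN has_bochner_integral_integral_eq]
    by simp
  finally show ?thesis by simp
qed

lemma has_bochner_integral_lebesgue_on_iff:
  fixes h :: "'a::euclidean_space \<Rightarrow> real"
  assumes "U \<in> sets lebesgue" "h \<in> borel_measurable borel" "\<And>x. x \<notin> U \<Longrightarrow> h x = 0"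
  shows "has_bochner_integral (lebesgue_on U) h I \<longleftrightarrow> has_bochner_integral lborel h I"
proof -
  have "(\<lambda>x. indicator U x *\<^sub>R h x) = h"
    using assms(3) by (force simp: indicator_def)
  then have "has_bochner_integral (lebesgue_on U) h I \<longleftrightarrow> has_bochner_integral lebesgue h I"
    using assms(1) by (simp add: has_bochner_integral_restrict_space)
  then show ?thesis
    using assms(2) by (simp add: has_bochner_integral_iff integrable_completion integral_completion)
qed

context
  fixes U :: "'a::euclidean_space set" and \<phi> :: "'a \<Rightarrow> real"
  assumes U: "open U" and \<phi>: "test_fun U \<phi>"
begin

lemma has_bochner_integral_test_fun:
  "has_bochner_integral (lebesgue_on U) \<phi> (\<integral>x. \<phi> x \<partial>lborel)"
proof -
  obtain K where K: "compact K" "K \<subseteq> U" "\<And>x. x \<notin> K \<Longrightarrow> \<phi> x = 0"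
    using \<phi> by (rule test_funE) blast
  have cont: "continuous_on UNIV \<phi>"
    using \<phi> by (intro smooth_fun_continuous_on test_fun_smooth)
  show ?thesis
    using integrable_lborel_compact_support[OF cont K(1,3)] K(2,3) U
    by (subst has_bochner_integral_lebesgue_on_iff)
      (auto intro: borel_measurable_continuous_onI[OF cont] has_bochner_integral_integrable)
qed

lemma integral_dir_deriv_test_fun:
  assumes "i \<in> Basis"
  shows "(\<integral>x. dir_deriv i \<phi> x \<partial>lborel) = 0"
proof -
  obtain K where K: "compact K" "\<And>x. x \<notin> K \<Longrightarrow> \<phi> x = 0"
    using \<phi> by (rule test_funE) blast
  show ?thesis
    using \<phi> assms
    by (intro integral_dir_deriv_eq_0[OF _ _ K] smooth_fun_differentiable
        smooth_fun_continuous_on smooth_fun_dir_deriv test_fun_smooth)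
qed

end

lemma sq_integrable_test_fun:
  assumes "open U" "test_fun U \<phi>"
  shows "sq_integrable (lebesgue_on U) \<phi>"
proof -
  have "test_fun U (\<phi> * \<phi>)"
    using assms(2) by (intro test_fun_mult test_fun_smooth)
  then show ?thesis
    using has_bochner_integral_test_fun[OF assms] has_bochner_integral_test_fun[OF assms(1)]
    by (auto simp: sq_integrable_def has_bochner_integral_iff power2_eq_square times_fun_def)
qed

lemma sq_integrable_cgrad:
  assumes "open U" "test_fun U \<phi>"
  shows "sq_integrable (lebesgue_on U) (cgrad \<phi>)"
proof -
  have "cgrad \<phi> = (\<Sum>i\<in>Basis. (\<lambda>x. dir_deriv i \<phi> x *\<^sub>R i))"
    by (simp add: cgrad_def fun_eq_iff)
  then show ?thesis
    using assms
    by (simp only:) (intro sq_integrable_sum sq_integrable_scaleR_const sq_integrable_test_fun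
        test_fun_dir_deriv)
qed

lemma L2_inner_cgrad_cgrad:
  assumes U: "open U" and \<phi>: "test_fun U \<phi>" and \<psi>: "test_fun U \<psi>"
  shows "L2_inner (lebesgue_on U) (cgrad \<phi>) (cgrad \<psi>) = - L2_inner (lebesgue_on U) \<phi> (laplacian \<psi>)"
proof -
  define flux where "flux i = \<phi> * dir_deriv i \<psi>" for i
  have flux: "test_fun U (flux i)" if "i \<in> Basis" for i
    unfolding flux_def using \<phi> \<psi> that
    by (intro test_fun_mult test_fun_smooth test_fun_dir_deriv)
  have divergence:
    "(\<Sum>i\<in>Basis. dir_deriv i (flux i) x) = cgrad \<phi> x \<bullet> cgrad \<psi> x + \<phi> x \<bullet> laplacian \<psi> x" for x
  proof -
    have "dir_deriv i (flux i) x
        = \<phi> x * dir_deriv i (dir_deriv i \<psi>) x + dir_deriv i \<phi> x * dir_deriv i \<psi> x"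
      if "i \<in> Basis" for i
      unfolding flux_def using \<phi>[THEN test_fun_smooth] \<psi>[THEN test_fun_smooth] that
      by (simp add: fun_cong[OF dir_deriv_mult] smooth_fun_differentiable smooth_fun_dir_deriv)
    then show ?thesis
      by (simp add: cgrad_inner_cgrad laplacian_def sum.distrib sum_distrib_left)
  qed
  have "has_bochner_integral (lebesgue_on U) (\<lambda>x. \<Sum>i\<in>Basis. dir_deriv i (flux i) x)
      (\<Sum>i\<in>(Basis :: 'a set). 0)"
    using has_bochner_integral_test_fun[OF U test_fun_dir_deriv[OF flux]]
      integral_dir_deriv_test_fun[OF U flux]
    by (intro has_bochner_integral_sum) simp
  then have "(\<integral>x. cgrad \<phi> x \<bullet> cgrad \<psi> x + \<phi> x \<bullet> laplacian \<psi> x \<partial>lebesgue_on U) = 0"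
    unfolding divergence by (simp add: has_bochner_integral_integral_eq)
  moreover have "integrable (lebesgue_on U) (\<lambda>x. cgrad \<phi> x \<bullet> cgrad \<psi> x)"
    using U \<phi> \<psi> by (intro integrable_inner_of_sq_integrable sq_integrable_cgrad)
  moreover have "integrable (lebesgue_on U) (\<lambda>x. \<phi> x \<bullet> laplacian \<psi> x)"
    using U \<phi> \<psi>
    by (intro integrable_inner_of_sq_integrable sq_integrable_test_fun test_fun_laplacian)
  ultimately show ?thesis
    by (simp add: L2_inner_def)
qed

subsection \<open>The Dirichlet form\<close>

lemma is_H10_grad_iff:
  "is_H10_grad U u G \<longleftrightarrow> sq_integrable (lebesgue_on U) u \<and> sq_integrable (lebesgue_on U) G \<and>
     (\<exists>\<phi>. (\<forall>k. test_fun U (\<phi> k)) \<and>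
        (\<lambda>k. L2_norm (lebesgue_on U) (\<phi> k - u)) \<longlonglongrightarrow> 0 \<and>
        (\<lambda>k. L2_norm (lebesgue_on U) (cgrad (\<phi> k) - G)) \<longlonglongrightarrow> 0)"
  by (simp add: is_H10_grad_def L2_iff_sq_integrable L2vec_iff_sq_integrable L2_norm_tendsto_0_iff)

lemma is_H10_gradI:
  assumes "sq_integrable (lebesgue_on U) u" "sq_integrable (lebesgue_on U) G"
    and "\<And>k. test_fun U (\<phi> k)"
    and "(\<lambda>k. L2_norm (lebesgue_on U) (\<phi> k - u)) \<longlonglongrightarrow> 0"
    and "(\<lambda>k. L2_norm (lebesgue_on U) (cgrad (\<phi> k) - G)) \<longlonglongrightarrow> 0"
  shows "is_H10_grad U u G"
  unfolding is_H10_grad_iff using assms by (intro conjI exI[of _ \<phi>]) simp_all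

lemma is_H10_gradE:
  assumes "is_H10_grad U u G"
  obtains \<phi> where "\<And>k. test_fun U (\<phi> k)"
    and "(\<lambda>k. L2_norm (lebesgue_on U) (\<phi> k - u)) \<longlonglongrightarrow> 0"
    and "(\<lambda>k. L2_norm (lebesgue_on U) (cgrad (\<phi> k) - G)) \<longlonglongrightarrow> 0"
    and "sq_integrable (lebesgue_on U) u" "sq_integrable (lebesgue_on U) G"
  using assms unfolding is_H10_grad_iff by blast

lemma is_H10_grad_sq_integrable: "is_H10_grad U u G \<Longrightarrow> sq_integrable (lebesgue_on U) G"
  by (simp add: is_H10_grad_iff)

lemma is_H10_grad_test_fun:
  assumes "open U" "test_fun U \<phi>"
  shows "is_H10_grad U \<phi> (cgrad \<phi>)"
  using assms by (intro is_H10_gradI[of _ _ _ "\<lambda>_. \<phi>"])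
    (simp_all add: sq_integrable_test_fun sq_integrable_cgrad L2_norm_eq)

lemma is_H10_grad_add:
  assumes U: "open U" and u: "is_H10_grad U u G" and v: "is_H10_grad U v H"
  shows "is_H10_grad U (u + v) (G + H)"
proof -
  let ?M = "lebesgue_on U"
  obtain \<phi> where \<phi>: "\<And>k. test_fun U (\<phi> k)" "(\<lambda>k. L2_norm ?M (\<phi> k - u)) \<longlonglongrightarrow> 0"
      "(\<lambda>k. L2_norm ?M (cgrad (\<phi> k) - G)) \<longlonglongrightarrow> 0"
    and uG: "sq_integrable ?M u" "sq_integrable ?M G"
    using u by (rule is_H10_gradE) blast
  obtain \<psi> where \<psi>: "\<And>k. test_fun U (\<psi> k)" "(\<lambda>k. L2_norm ?M (\<psi> k - v)) \<longlonglongrightarrow> 0"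
      "(\<lambda>k. L2_norm ?M (cgrad (\<psi> k) - H)) \<longlonglongrightarrow> 0"
    and vH: "sq_integrable ?M v" "sq_integrable ?M H"
    using v by (rule is_H10_gradE) blast
  note sq_integrable = sq_integrable_test_fun[OF U] sq_integrable_cgrad[OF U] \<phi>(1) \<psi>(1) uG vH
  have "cgrad (\<phi> k + \<psi> k) = cgrad (\<phi> k) + cgrad (\<psi> k)" for k
    using \<phi>(1) \<psi>(1) by (intro cgrad_add test_fun_smooth)
  then have "(\<lambda>k. L2_norm ?M (cgrad (\<phi> k + \<psi> k) - (G + H))) \<longlonglongrightarrow> 0"
    using L2.seminorm_tendsto_add[OF _ _ \<phi>(3) _ _ \<psi>(3)] by (simp add: sq_integrable)
  moreover have "(\<lambda>k. L2_norm ?M (\<phi> k + \<psi> k - (u + v))) \<longlonglongrightarrow> 0"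
    using L2.seminorm_tendsto_add[OF _ _ \<phi>(2) _ _ \<psi>(2)] by (simp add: sq_integrable)
  moreover have "sq_integrable ?M (u + v)" "sq_integrable ?M (G + H)"
    using uG vH by (simp_all only: sq_integrable_add)
  ultimately show ?thesis
    using test_fun_add[OF \<phi>(1) \<psi>(1)] by (intro is_H10_gradI[of _ _ _ "\<lambda>k. \<phi> k + \<psi> k"])
qed

lemma is_H10_grad_scaleR:
  assumes U: "open U" and u: "is_H10_grad U u G"
  shows "is_H10_grad U (c *\<^sub>R u) (c *\<^sub>R G)"
proof -
  let ?M = "lebesgue_on U"
  obtain \<phi> where \<phi>: "\<And>k. test_fun U (\<phi> k)" "(\<lambda>k. L2_norm ?M (\<phi> k - u)) \<longlonglongrightarrow> 0"
      "(\<lambda>k. L2_norm ?M (cgrad (\<phi> k) - G)) \<longlonglongrightarrow> 0"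
    and uG: "sq_integrable ?M u" "sq_integrable ?M G"
    using u by (rule is_H10_gradE) blast
  note sq_integrable = sq_integrable_test_fun[OF U] sq_integrable_cgrad[OF U] \<phi>(1) uG
  have "cgrad (c *\<^sub>R \<phi> k) = c *\<^sub>R cgrad (\<phi> k)" for k
    using \<phi>(1) by (intro cgrad_scaleR test_fun_smooth)
  then have "(\<lambda>k. L2_norm ?M (cgrad (c *\<^sub>R \<phi> k) - c *\<^sub>R G)) \<longlonglongrightarrow> 0"
    using L2.seminorm_tendsto_scaleR[OF _ _ \<phi>(3)] by (simp add: sq_integrable)
  moreover have "(\<lambda>k. L2_norm ?M (c *\<^sub>R \<phi> k - c *\<^sub>R u)) \<longlonglongrightarrow> 0"
    using L2.seminorm_tendsto_scaleR[OF _ _ \<phi>(2)] by (simp add: sq_integrable)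
  moreover have "sq_integrable ?M (c *\<^sub>R u)" "sq_integrable ?M (c *\<^sub>R G)"
    using uG by (simp_all only: sq_integrable_scaleR)
  ultimately show ?thesis
    using test_fun_scaleR[OF \<phi>(1)] by (intro is_H10_gradI[of _ _ _ "\<lambda>k. c *\<^sub>R \<phi> k"])
qed

lemma is_H10_grad_diff:
  assumes "open U" "is_H10_grad U u G" "is_H10_grad U v H"
  shows "is_H10_grad U (u - v) (G - H)"
  using is_H10_grad_add[OF assms(1,2) is_H10_grad_scaleR[OF assms(1,3), of "- 1"]] by simp

text \<open>If test functions \<open>\<eta>\<^sub>k\<close> tend to 0 in \<open>L\<^sup>2\<close> and their gradients to \<open>W\<close>, then \<open>W\<close> is
  orthogonal to each \<open>\<nabla>\<eta>\<^sub>k\<close>, as \<open>\<langle>\<nabla>\<eta>\<^sub>m, \<nabla>\<eta>\<^sub>k\<rangle> = - \<langle>\<eta>\<^sub>m, \<Delta>\<eta>\<^sub>k\<rangle>\<close> tends to 0 for \<open>m \<rightarrow> \<infinity>\<close>, and hence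
  to itself.\<close>

lemma is_H10_grad_0_imp_AE_eq_0:
  assumes U: "open U" and W: "is_H10_grad U 0 W"
  shows "AE x in lebesgue_on U. W x = 0"
proof -
  let ?M = "lebesgue_on U"
  obtain \<eta> where \<eta>: "\<And>k. test_fun U (\<eta> k)" "(\<lambda>k. L2_norm ?M (\<eta> k - 0)) \<longlonglongrightarrow> 0"
      "(\<lambda>k. L2_norm ?M (cgrad (\<eta> k) - W)) \<longlonglongrightarrow> 0"
    and "sq_integrable ?M W"
    using W by (rule is_H10_gradE) blast
  note mem = sq_integrable_test_fun[OF U] sq_integrable_cgrad[OF U] test_fun_laplacian \<eta>(1)
    \<open>sq_integrable ?M W\<close> sq_integrable_0
  have orthogonal: "L2_inner ?M (cgrad (\<eta> k)) W = 0" for k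
  proof -
    have "(\<lambda>m. L2_inner ?M (cgrad (\<eta> m)) (cgrad (\<eta> k))) \<longlonglongrightarrow> L2_inner ?M W (cgrad (\<eta> k))"
      by (rule L2.tendsto_form_left[OF _ _ \<eta>(3)]) (simp_all add: mem)
    moreover have "(\<lambda>m. - L2_inner ?M (\<eta> m) (laplacian (\<eta> k))) \<longlonglongrightarrow> - L2_inner ?M 0 (laplacian (\<eta> k))"
      by (intro tendsto_minus L2.tendsto_form_left[OF _ _ \<eta>(2)]) (simp_all add: mem)
    ultimately show ?thesis
      unfolding L2_inner_cgrad_cgrad[OF U \<eta>(1) \<eta>(1)]
      by (subst L2_inner_commute) (auto dest: LIMSEQ_unique simp: L2_inner_def)
  qed
  have "(\<lambda>k. L2_inner ?M (cgrad (\<eta> k)) W) \<longlonglongrightarrow> L2_inner ?M W W"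
    by (rule L2.tendsto_form_left[OF _ _ \<eta>(3)]) (simp_all add: mem)
  then have "L2_inner ?M W W = 0"
    using orthogonal by (simp add: LIMSEQ_const_iff)
  then have "AE x in ?M. W x \<bullet> W x = 0"
    unfolding L2_inner_def
    by (subst (asm) integral_nonneg_eq_0_iff_AE)
      (simp_all add: integrable_inner_of_sq_integrable mem)
  then show ?thesis by simp
qed

lemma is_H10_grad_AE_unique:
  assumes U: "open U" and "is_H10_grad U u G" "is_H10_grad U u H"
  shows "AE x in lebesgue_on U. G x = H x"
proof -
  have "is_H10_grad U 0 (G - H)"
    using is_H10_grad_diff[OF assms] by simp
  from is_H10_grad_0_imp_AE_eq_0[OF U this] show ?thesis by simp
qed

lemma H10I: "is_H10_grad U u G \<Longrightarrow> u \<in> H10 U"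
  by (auto simp: H10_def)

lemma is_H10_grad_H10_grad: "u \<in> H10 U \<Longrightarrow> is_H10_grad U u (H10_grad U u)"
  unfolding H10_def H10_grad_def by (simp add: someI_ex)

lemma test_fun_in_H10: "open U \<Longrightarrow> test_fun U \<phi> \<Longrightarrow> \<phi> \<in> H10 U"
  by (rule H10I[OF is_H10_grad_test_fun])

lemma subspace_H10:
  assumes "open U"
  shows "subspace (H10 U)"
proof (rule subspaceI)
  show "0 \<in> H10 U"
    using test_fun_in_H10[OF assms] subspace_0[OF subspace_test_fun] by blast
qed (use assms in \<open>blast intro: H10I is_H10_grad_H10_grad is_H10_grad_add is_H10_grad_scaleR\<close>)+

lemma dirichlet_eq_L2_inner:
  assumes U: "open U" and u: "is_H10_grad U u G" and v: "is_H10_grad U v H"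
  shows "dirichlet U u v = L2_inner (lebesgue_on U) G H"
proof -
  have grad: "is_H10_grad U u (H10_grad U u)" "is_H10_grad U v (H10_grad U v)"
    using u v by (auto intro: is_H10_grad_H10_grad H10I)
  note [measurable] = sq_integrable_imp_measurable[OF is_H10_grad_sq_integrable]
  show ?thesis
    unfolding dirichlet_def L2_inner_def
    using is_H10_grad_AE_unique[OF U grad(1) u] is_H10_grad_AE_unique[OF U grad(2) v] grad u v
    by (intro integral_cong_AE) auto
qed

abbreviation dirichlet_norm :: "'a::euclidean_space set \<Rightarrow> ('a \<Rightarrow> real) \<Rightarrow> real" where
  "dirichlet_norm U \<equiv> form_norm (dirichlet U)"

lemma dirichlet_norm_eq_L2_norm:
  "open U \<Longrightarrow> is_H10_grad U u G \<Longrightarrow> dirichlet_norm U u = L2_norm (lebesgue_on U) G"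
  by (simp add: form_norm_def dirichlet_eq_L2_inner)

lemma semi_inner_product_dirichlet:
  fixes U :: "'a::euclidean_space set"
  assumes U: "open U"
  shows "semi_inner_product (H10 U) (dirichlet U)"
proof
  show "subspace (H10 U)" by (rule subspace_H10[OF U])
  show "dirichlet U u v = dirichlet U v u" for u v
    by (simp add: dirichlet_def inner_commute)
  show "0 \<le> dirichlet U u u" for u
    by (simp add: dirichlet_def)
  fix u v assume uv: "u \<in> H10 U" "v \<in> H10 U"
  note grad = uv[THEN is_H10_grad_H10_grad]
  note mem = grad[THEN is_H10_grad_sq_integrable]
  show "dirichlet U (c *\<^sub>R u) v = c * dirichlet U u v" for c
    by (simp add: dirichlet_eq_L2_inner[OF U is_H10_grad_scaleR[OF U grad(1)] grad(2)]
        dirichlet_eq_L2_inner[OF U grad] L2.form_scaleR_left mem)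
  fix w assume w: "w \<in> H10 U"
  note grad_w = is_H10_grad_H10_grad[OF w]
  show "dirichlet U (u + v) w = dirichlet U u w + dirichlet U v w"
    by (simp add: dirichlet_eq_L2_inner[OF U is_H10_grad_add[OF U grad] grad_w]
        dirichlet_eq_L2_inner[OF U grad(1) grad_w] dirichlet_eq_L2_inner[OF U grad(2) grad_w]
        L2.form_add_left mem is_H10_grad_sq_integrable[OF grad_w])
qed

subsection \<open>Tensor products of square integrable functions\<close>

lemma null_sets_lborel_fst_vimage:
  assumes "N \<in> null_sets (lborel :: 'a::euclidean_space measure)"
  shows "(fst -` N :: ('a \<times> 'b::euclidean_space) set) \<in> null_sets lborel"
proof -
  have "N \<times> (UNIV :: 'b set) \<in> null_sets (lborel \<Otimes>\<^sub>M lborel)"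
    using assms by (intro lborel.times_in_null_sets1) simp_all
  also have "N \<times> UNIV = fst -` N" by auto
  finally show ?thesis by (simp add: lborel_prod)
qed

lemma null_sets_lborel_snd_vimage:
  assumes "N \<in> null_sets (lborel :: 'b::euclidean_space measure)"
  shows "(snd -` N :: ('a::euclidean_space \<times> 'b) set) \<in> null_sets lborel"
proof -
  have "(UNIV :: 'a set) \<times> N \<in> null_sets (lborel \<Otimes>\<^sub>M lborel)"
    using assms by (intro lborel.times_in_null_sets2) simp_all
  also have "UNIV \<times> N = snd -` N" by auto
  finally show ?thesis by (simp add: lborel_prod)
qed

lemma AE_lborel_vimage:
  assumes null: "\<And>N. N \<in> null_sets lborel \<Longrightarrow> h -` N \<in> null_sets lborel"
    and "AE x in lborel. P x"
  shows "AE z in lborel. P (h z)"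
proof -
  obtain N where "{x. \<not> P x} \<subseteq> N" "N \<in> null_sets lborel"
    using \<open>AE x in lborel. P x\<close> by (auto simp: eventually_ae_filter)
  then show ?thesis
    by (intro AE_I'[OF null]) auto
qed

lemma measurable_lebesgue_vimage:
  assumes "h \<in> borel \<rightarrow>\<^sub>M borel"
    and null: "\<And>N. N \<in> null_sets lborel \<Longrightarrow> h -` N \<in> null_sets lborel"
  shows "h \<in> lebesgue \<rightarrow>\<^sub>M lebesgue"
proof (rule completion.measurable_completion2)
  show h: "h \<in> lebesgue \<rightarrow>\<^sub>M lborel"
    using assms(1) by (intro measurable_completion) simp
  have "N \<in> null_sets (distr lebesgue lborel h)" if "N \<in> null_sets lborel" for N
    using null_sets_completionI[OF null[OF that]] null_setsD2[OF that]
    by (simp add: null_sets_distr_iff[OF h])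
  then show "null_sets lborel \<subseteq> null_sets (distr lebesgue lborel h)" by blast
qed

lemma measurable_fst_lebesgue:
  "(fst :: 'a::euclidean_space \<times> 'b::euclidean_space \<Rightarrow> 'a) \<in> lebesgue \<rightarrow>\<^sub>M lebesgue"
  by (rule measurable_lebesgue_vimage)
    (simp_all add: null_sets_lborel_fst_vimage flip: borel_prod)

lemma measurable_snd_lebesgue:
  "(snd :: 'a::euclidean_space \<times> 'b::euclidean_space \<Rightarrow> 'b) \<in> lebesgue \<rightarrow>\<^sub>M lebesgue"
  by (rule measurable_lebesgue_vimage)
    (simp_all add: null_sets_lborel_snd_vimage flip: borel_prod)

lemma nn_integral_lebesgue_Times:
  fixes f :: "'a::euclidean_space \<Rightarrow> ennreal" and g :: "'b::euclidean_space \<Rightarrow> ennreal"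
  assumes "f \<in> borel_measurable lebesgue" "g \<in> borel_measurable lebesgue"
  shows "(\<integral>\<^sup>+z. f (fst z) * g (snd z) \<partial>lebesgue) = (\<integral>\<^sup>+x. f x \<partial>lebesgue) * (\<integral>\<^sup>+y. g y \<partial>lebesgue)"
proof -
  obtain f' where f': "f' \<in> borel_measurable lborel" "AE x in lborel. f x = f' x"
    using completion_ex_borel_measurable[OF assms(1)] by blast
  obtain g' where g': "g' \<in> borel_measurable lborel" "AE y in lborel. g y = g' y"
    using completion_ex_borel_measurable[OF assms(2)] by blast
  note [measurable] = f'(1) g'(1)
  have "AE z in (lborel :: ('a \<times> 'b) measure). f (fst z) = f' (fst z)"
    by (rule AE_lborel_vimage[OF _ f'(2)]) (rule null_sets_lborel_fst_vimage)
  moreover have "AE z in (lborel :: ('a \<times> 'b) measure). g (snd z) = g' (snd z)"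
    by (rule AE_lborel_vimage[OF _ g'(2)]) (rule null_sets_lborel_snd_vimage)
  ultimately have "AE z in (lborel :: ('a \<times> 'b) measure).
      f (fst z) * g (snd z) = f' (fst z) * g' (snd z)"
    by eventually_elim simp
  then have "(\<integral>\<^sup>+z. f (fst z) * g (snd z) \<partial>lebesgue)
      = (\<integral>\<^sup>+z. f' (fst z) * g' (snd z) \<partial>(lborel \<Otimes>\<^sub>M lborel))"
    unfolding nn_integral_completion lborel_prod by (rule nn_integral_cong_AE)
  also have "\<dots> = (\<integral>\<^sup>+x. \<integral>\<^sup>+y. f' x * g' y \<partial>lborel \<partial>lborel)"
    by (subst lborel.nn_integral_fst[symmetric]) simp_all
  also have "\<dots> = (\<integral>\<^sup>+x. f' x \<partial>lborel) * (\<integral>\<^sup>+y. g' y \<partial>lborel)"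
    by (simp add: nn_integral_cmult nn_integral_multc)
  also have "\<dots> = (\<integral>\<^sup>+x. f x \<partial>lebesgue) * (\<integral>\<^sup>+y. g y \<partial>lebesgue)"
    unfolding nn_integral_completion
    using nn_integral_cong_AE[OF f'(2)] nn_integral_cong_AE[OF g'(2)] by simp
  finally show ?thesis .
qed

lemma sets_lebesgue_Times:
  assumes "A \<in> sets lebesgue" "B \<in> sets lebesgue"
  shows "A \<times> B \<in> sets lebesgue"
proof -
  have "A \<times> B = (fst -` A \<inter> space lebesgue) \<inter> (snd -` B \<inter> space lebesgue)" by auto
  then show ?thesis
    using measurable_sets[OF measurable_fst_lebesgue assms(1)]
      measurable_sets[OF measurable_snd_lebesgue assms(2)] by (metis sets.Int)
qed

lemma nn_integral_lebesgue_on_Times: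
  fixes f :: "'a::euclidean_space \<Rightarrow> ennreal" and g :: "'b::euclidean_space \<Rightarrow> ennreal"
  assumes AB: "A \<in> sets lebesgue" "B \<in> sets lebesgue"
    and f: "f \<in> borel_measurable (lebesgue_on A)" and g: "g \<in> borel_measurable (lebesgue_on B)"
  shows "(\<integral>\<^sup>+z. f (fst z) * g (snd z) \<partial>lebesgue_on (A \<times> B))
    = (\<integral>\<^sup>+x. f x \<partial>lebesgue_on A) * (\<integral>\<^sup>+y. g y \<partial>lebesgue_on B)"
proof -
  have "(\<integral>\<^sup>+z. f (fst z) * g (snd z) \<partial>lebesgue_on (A \<times> B))
      = (\<integral>\<^sup>+z. (f (fst z) * indicator A (fst z)) * (g (snd z) * indicator B (snd z)) \<partial>lebesgue)"
    using sets_lebesgue_Times[OF AB]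
    by (simp add: nn_integral_restrict_space indicator_times mult_ac)
  also have "\<dots> = (\<integral>\<^sup>+x. f x * indicator A x \<partial>lebesgue) * (\<integral>\<^sup>+y. g y * indicator B y \<partial>lebesgue)"
    using f g AB
    by (intro nn_integral_lebesgue_Times)
      (simp_all add: borel_measurable_restrict_space_iff_ennreal)
  finally show ?thesis
    using AB by (simp add: nn_integral_restrict_space)
qed

lemma tensor_eq: "tensor p q = (\<lambda>z. p (fst z) * q (snd z))"
  by (simp add: tensor_def case_prod_beta')

lemma
  assumes AB: "A \<in> sets lebesgue" "B \<in> sets lebesgue"
    and p: "sq_integrable (lebesgue_on A) p" and q: "sq_integrable (lebesgue_on B) q"
  shows sq_integrable_tensor: "sq_integrable (lebesgue_on (A \<times> B)) (tensor p q)"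
    and L2_norm_tensor:
      "L2_norm (lebesgue_on (A \<times> B)) (tensor p q)
        = L2_norm (lebesgue_on A) p * L2_norm (lebesgue_on B) q"
proof -
  let ?M = "lebesgue_on (A \<times> B)"
    and ?Ip = "\<integral>x. (norm (p x))\<^sup>2 \<partial>lebesgue_on A" and ?Iq = "\<integral>y. (norm (q y))\<^sup>2 \<partial>lebesgue_on B"
  note [measurable] = p[THEN sq_integrable_imp_measurable] q[THEN sq_integrable_imp_measurable]
  have [measurable]: "fst \<in> ?M \<rightarrow>\<^sub>M lebesgue_on A" "snd \<in> ?M \<rightarrow>\<^sub>M lebesgue_on B"
    by (auto intro: measurable_restrict_space3 measurable_fst_lebesgue measurable_snd_lebesgue)
  have measurable: "tensor p q \<in> borel_measurable ?M"
    unfolding tensor_eq by measurable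
  have "has_bochner_integral ?M (\<lambda>z. (norm (tensor p q z))\<^sup>2) (?Ip * ?Iq)"
  proof (rule has_bochner_integral_nn_integral)
    have "(\<integral>\<^sup>+z. (norm (tensor p q z))\<^sup>2 \<partial>?M)
        = (\<integral>\<^sup>+z. ennreal ((norm (p (fst z)))\<^sup>2) * ennreal ((norm (q (snd z)))\<^sup>2) \<partial>?M)"
      by (simp add: tensor_eq power_mult_distrib ennreal_mult)
    also have "\<dots> = (\<integral>\<^sup>+x. (norm (p x))\<^sup>2 \<partial>lebesgue_on A) * (\<integral>\<^sup>+y. (norm (q y))\<^sup>2 \<partial>lebesgue_on B)"
      by (rule nn_integral_lebesgue_on_Times[OF AB]) measurable
    also have "\<dots> = ennreal (?Ip * ?Iq)"
      using p[THEN sq_integrable_imp_integrable] q[THEN sq_integrable_imp_integrable]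
      by (simp add: nn_integral_eq_integral ennreal_mult)
    finally show "(\<integral>\<^sup>+z. (norm (tensor p q z))\<^sup>2 \<partial>?M) = \<dots>" .
  qed (use measurable in simp_all)
  then show "sq_integrable ?M (tensor p q)"
    "L2_norm ?M (tensor p q) = L2_norm (lebesgue_on A) p * L2_norm (lebesgue_on B) q"
    using measurable
    by (simp_all add: sq_integrable_def L2_norm_eq has_bochner_integral_iff real_sqrt_mult)
qed

lemma tensor_diff_left: "tensor (p - p') q = tensor p q - tensor p' q"
  and tensor_diff_right: "tensor p (q - q') = tensor p q - tensor p q'"
  and tensor_scaleR_left: "tensor (c *\<^sub>R p) q = c *\<^sub>R tensor p q"
  and tensor_mult: "tensor p q * tensor p' q' = tensor (p * p') (q * q')"
  by (simp_all add: tensor_eq fun_eq_iff algebra_simps)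

lemma L2_norm_tensor_tendsto:
  assumes AB: "A \<in> sets lebesgue" "B \<in> sets lebesgue"
    and p: "\<And>n. sq_integrable (lebesgue_on A) (p n)" "sq_integrable (lebesgue_on A) p0"
    and q: "\<And>n. sq_integrable (lebesgue_on B) (q n)" "sq_integrable (lebesgue_on B) q0"
    and p_lim: "(\<lambda>n. L2_norm (lebesgue_on A) (p n - p0)) \<longlonglongrightarrow> 0"
    and q_lim: "(\<lambda>n. L2_norm (lebesgue_on B) (q n - q0)) \<longlonglongrightarrow> 0"
  shows "(\<lambda>n. L2_norm (lebesgue_on (A \<times> B)) (tensor (p n) (q n) - tensor p0 q0)) \<longlonglongrightarrow> 0"
proof (rule Lim_null_comparison)
  let ?NA = "L2_norm (lebesgue_on A)" and ?NB = "L2_norm (lebesgue_on B)"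
    and ?NAB = "L2_norm (lebesgue_on (A \<times> B))"
  have diff: "sq_integrable (lebesgue_on A) (p n - p0)"
    "sq_integrable (lebesgue_on B) (q n - q0)" for n
    using p q by (simp_all only: sq_integrable_diff)
  have "?NAB (tensor (p n) (q n) - tensor p0 q0)
      \<le> ?NA (p n - p0) * ?NB (q n) + ?NA p0 * ?NB (q n - q0)" for n
    using L2.seminorm_triangle
      [of "tensor (p n - p0) (q n)" "lebesgue_on (A \<times> B)" "tensor p0 (q n - q0)"]
    by (simp add: sq_integrable_tensor[OF AB] L2_norm_tensor[OF AB] p q diff)
      (simp add: tensor_diff_left tensor_diff_right)
  then show "\<forall>\<^sub>F n in sequentially. norm (?NAB (tensor (p n) (q n) - tensor p0 q0))
      \<le> ?NA (p n - p0) * ?NB (q n) + ?NA p0 * ?NB (q n - q0)"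
    by (simp add: L2_norm_eq)
  have "(\<lambda>n. ?NB (q n)) \<longlonglongrightarrow> ?NB q0"
    using L2.tendsto_seminorm[OF _ _ q_lim] q by simp
  then have "(\<lambda>n. ?NA (p n - p0) * ?NB (q n) + ?NA p0 * ?NB (q n - q0)) \<longlonglongrightarrow> 0 * ?NB q0 + ?NA p0 * 0"
    by (intro tendsto_intros p_lim q_lim)
  then show "(\<lambda>n. ?NA (p n - p0) * ?NB (q n) + ?NA p0 * ?NB (q n - q0)) \<longlonglongrightarrow> 0" by simp
qed

subsection \<open>Tensor products of smooth and of \<open>H\<^sup>1\<^sub>0\<close> functions\<close>

definition tensors :: "(real \<Rightarrow> real) set \<Rightarrow> (real \<Rightarrow> real) set \<Rightarrow> (real \<times> real \<Rightarrow> real) set" where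
  "tensors V W = {tensor p q | p q. p \<in> V \<and> q \<in> W}"

abbreviation smooth_tensors :: "(real \<times> real \<Rightarrow> real) set" where
  "smooth_tensors \<equiv> span (tensors (Collect smooth_fun) (Collect smooth_fun))"

abbreviation test_tensors :: "real set \<Rightarrow> real set \<Rightarrow> (real \<times> real \<Rightarrow> real) set" where
  "test_tensors A B \<equiv> span (tensors (Collect (test_fun A)) (Collect (test_fun B)))"

lemma tensor_in_tensors: "p \<in> V \<Longrightarrow> q \<in> W \<Longrightarrow> tensor p q \<in> tensors V W"
  by (auto simp: tensors_def)

lemma tensorsE:
  assumes "h \<in> tensors V W"
  obtains p q where "p \<in> V" "q \<in> W" "h = tensor p q"
  using assms by (auto simp: tensors_def)

lemma tensors_mono: "V \<subseteq> V' \<Longrightarrow> W \<subseteq> W' \<Longrightarrow> tensors V W \<subseteq> tensors V' W'"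
  by (auto simp: tensors_def)

lemma tensors_scaleR: "subspace V \<Longrightarrow> h \<in> tensors V W \<Longrightarrow> c *\<^sub>R h \<in> tensors V W"
  by (auto elim!: tensorsE intro!: tensor_in_tensors intro: subspace_scale[of V]
      simp flip: tensor_scaleR_left)

lemma Basis_real_prod: "(Basis :: (real \<times> real) set) = {(1, 0), (0, 1)}"
  by (auto simp: Basis_prod_def)

lemma has_derivative_tensor:
  assumes "smooth_fun p" "smooth_fun q"
  shows "(tensor p q has_derivative
    (\<lambda>h. p (fst z) * (dir_deriv 1 q (snd z) * snd h) + dir_deriv 1 p (fst z) * fst h * q (snd z)))
    (at z)"
proof -
  have p: "(p has_derivative (\<lambda>h. dir_deriv 1 p (fst z) * h)) (at (fst z))"
    and q: "(q has_derivative (\<lambda>h. dir_deriv 1 q (snd z) * h)) (at (snd z))"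
    using assms[THEN smooth_fun_has_real_derivative] by (auto simp: has_field_derivative_def)
  show ?thesis
    unfolding tensor_eq
    by (intro has_derivative_mult
        has_derivative_compose[OF has_derivative_fst[OF has_derivative_ident] p]
        has_derivative_compose[OF has_derivative_snd[OF has_derivative_ident] q])
qed

lemma dir_deriv_tensor:
  assumes "smooth_fun p" "smooth_fun q"
  shows "dir_deriv (1, 0) (tensor p q) = tensor (dir_deriv 1 p) q"
    and "dir_deriv (0, 1) (tensor p q) = tensor p (dir_deriv 1 q)"
  by (simp_all only: dir_derivI[OF has_derivative_tensor[OF assms]]) (simp_all add: tensor_eq)

lemma smooth_tensors_subset_smooth_fun:
  "smooth_tensors \<subseteq> Collect smooth_fun"
proof (rule span_subset_smooth_fun)
  fix h assume "h \<in> tensors (Collect smooth_fun) (Collect smooth_fun)"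
  then obtain p q where h: "smooth_fun p" "smooth_fun q" "h = tensor p q"
    by (auto elim!: tensorsE)
  show "h differentiable (at x)" for x
    unfolding h(3) using has_derivative_tensor[OF h(1,2)] by (rule differentiableI)
  show "dir_deriv i h \<in> smooth_tensors" if "i \<in> Basis" for i
    using that h dir_deriv_tensor[OF h(1,2)]
    by (auto simp: Basis_real_prod intro!: span_base tensor_in_tensors smooth_fun_dir_deriv)
qed

lemma smooth_fun_tensor: "smooth_fun p \<Longrightarrow> smooth_fun q \<Longrightarrow> smooth_fun (tensor p q)"
  using smooth_tensors_subset_smooth_fun by (auto intro: span_base tensor_in_tensors)

lemma test_fun_tensor:
  assumes "test_fun A p" "test_fun B q"
  shows "test_fun (A \<times> B) (tensor p q)"
proof -
  obtain K where K: "compact K" "K \<subseteq> A" "\<And>x. x \<notin> K \<Longrightarrow> p x = 0"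
    using assms(1) by (rule test_funE) blast
  obtain L where L: "compact L" "L \<subseteq> B" "\<And>x. x \<notin> L \<Longrightarrow> q x = 0"
    using assms(2) by (rule test_funE) blast
  show ?thesis
  proof (rule test_funI[of _ "K \<times> L"])
    show "smooth_fun (tensor p q)"
      using assms by (intro smooth_fun_tensor test_fun_smooth)
    show "tensor p q z = 0" if "z \<notin> K \<times> L" for z
      using that K(3)[of "fst z"] L(3)[of "snd z"] by (cases z) (auto simp: tensor_eq)
  qed (use K L in \<open>auto intro: compact_Times\<close>)
qed

lemma cgrad_real_prod: "cgrad h z = (dir_deriv (1, 0) h z, dir_deriv (0, 1) h z)"
  by (simp add: cgrad_def Basis_real_prod)

lemma cgrad_tensor:
  assumes "smooth_fun p" "smooth_fun q"
  shows "cgrad (tensor p q) = (\<lambda>z. (tensor (cgrad p) q z, tensor p (cgrad q) z))"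
  using dir_deriv_tensor[OF assms] by (simp add: fun_eq_iff cgrad_real_prod cgrad_real)

lemma L2_norm_Pair_tendsto_0:
  fixes u v :: "nat \<Rightarrow> 'a \<Rightarrow> real"
  assumes "\<And>n. sq_integrable M (u n)" "\<And>n. sq_integrable M (v n)"
    and "(\<lambda>n. L2_norm M (u n)) \<longlonglongrightarrow> 0" "(\<lambda>n. L2_norm M (v n)) \<longlonglongrightarrow> 0"
  shows "(\<lambda>n. L2_norm M (\<lambda>x. (u n x, v n x))) \<longlonglongrightarrow> 0"
proof -
  have "L2_norm M (\<lambda>x. (u n x, v n x)) = sqrt ((L2_norm M (u n))\<^sup>2 + (L2_norm M (v n))\<^sup>2)" for n
    using assms(1,2)[of n, THEN sq_integrable_imp_integrable] by (simp add: L2_norm_eq norm_Pair)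
  moreover have "(\<lambda>n. sqrt ((L2_norm M (u n))\<^sup>2 + (L2_norm M (v n))\<^sup>2)) \<longlonglongrightarrow> sqrt (0\<^sup>2 + 0\<^sup>2)"
    by (intro tendsto_intros assms(3,4))
  ultimately show ?thesis by simp
qed

lemma is_H10_grad_tensor:
  assumes AB: "open A" "open B"
    and r: "is_H10_grad A r G" and s: "is_H10_grad B s H"
  shows "is_H10_grad (A \<times> B) (tensor r s) (\<lambda>z. (tensor G s z, tensor r H z))"
proof -
  let ?M = "lebesgue_on (A \<times> B)"
  have sets: "A \<in> sets lebesgue" "B \<in> sets lebesgue"
    using AB by simp_all
  obtain \<phi> where \<phi>: "\<And>k. test_fun A (\<phi> k)" "(\<lambda>k. L2_norm (lebesgue_on A) (\<phi> k - r)) \<longlonglongrightarrow> 0"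
      "(\<lambda>k. L2_norm (lebesgue_on A) (cgrad (\<phi> k) - G)) \<longlonglongrightarrow> 0"
    and rG: "sq_integrable (lebesgue_on A) r" "sq_integrable (lebesgue_on A) G"
    using r by (rule is_H10_gradE) blast
  obtain \<psi> where \<psi>: "\<And>k. test_fun B (\<psi> k)" "(\<lambda>k. L2_norm (lebesgue_on B) (\<psi> k - s)) \<longlonglongrightarrow> 0"
      "(\<lambda>k. L2_norm (lebesgue_on B) (cgrad (\<psi> k) - H)) \<longlonglongrightarrow> 0"
    and sH: "sq_integrable (lebesgue_on B) s" "sq_integrable (lebesgue_on B) H"
    using s by (rule is_H10_gradE) blast
  note mem = sq_integrable_test_fun[OF AB(1) \<phi>(1)] sq_integrable_cgrad[OF AB(1) \<phi>(1)] rG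
    sq_integrable_test_fun[OF AB(2) \<psi>(1)] sq_integrable_cgrad[OF AB(2) \<psi>(1)] sH
  show ?thesis
  proof (rule is_H10_gradI[where \<phi> = "\<lambda>k. tensor (\<phi> k) (\<psi> k)"])
    show "sq_integrable ?M (tensor r s)" "sq_integrable ?M (\<lambda>z. (tensor G s z, tensor r H z))"
      by (simp_all add: sq_integrable_Pair sq_integrable_tensor sets mem)
    show "test_fun (A \<times> B) (tensor (\<phi> k) (\<psi> k))" for k
      using \<phi>(1) \<psi>(1) by (rule test_fun_tensor)
    show "(\<lambda>k. L2_norm ?M (tensor (\<phi> k) (\<psi> k) - tensor r s)) \<longlonglongrightarrow> 0"
      by (rule L2_norm_tensor_tendsto[OF sets _ _ _ _ \<phi>(2) \<psi>(2)]) (simp_all add: mem)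
    have "(\<lambda>k. L2_norm ?M (\<lambda>z. ((tensor (cgrad (\<phi> k)) (\<psi> k) - tensor G s) z,
        (tensor (\<phi> k) (cgrad (\<psi> k)) - tensor r H) z))) \<longlonglongrightarrow> 0"
      by (intro L2_norm_Pair_tendsto_0 sq_integrable_diff sq_integrable_tensor mem sets
          L2_norm_tensor_tendsto[OF sets _ _ _ _ \<phi>(3) \<psi>(2)]
          L2_norm_tensor_tendsto[OF sets _ _ _ _ \<phi>(2) \<psi>(3)])
    then show "(\<lambda>k. L2_norm ?M
        (cgrad (tensor (\<phi> k) (\<psi> k)) - (\<lambda>z. (tensor G s z, tensor r H z)))) \<longlonglongrightarrow> 0"
      by (simp add: cgrad_tensor[OF test_fun_smooth[OF \<phi>(1)] test_fun_smooth[OF \<psi>(1)]] fun_diff_def)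
  qed
qed

lemma tensor_in_H10:
  "open A \<Longrightarrow> open B \<Longrightarrow> r \<in> H10 A \<Longrightarrow> s \<in> H10 B \<Longrightarrow> tensor r s \<in> H10 (A \<times> B)"
  by (rule H10I, rule is_H10_grad_tensor) (auto intro: is_H10_grad_H10_grad)

lemma tensors_H10_subset: "open A \<Longrightarrow> open B \<Longrightarrow> tensors (H10 A) (H10 B) \<subseteq> H10 (A \<times> B)"
  by (auto elim!: tensorsE intro: tensor_in_H10)

lemma test_tensors_subset_test_fun:
  "test_tensors A B \<subseteq> Collect (test_fun (A \<times> B))"
  by (rule span_minimal[OF _ subspace_test_fun]) (auto elim!: tensorsE intro: test_fun_tensor)

subsection \<open>Approximation by sums of tensor products\<close>

abbreviation mixed_deriv :: "(real \<times> real \<Rightarrow> real) \<Rightarrow> real \<times> real \<Rightarrow> real" where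
  "mixed_deriv h \<equiv> dir_deriv (0, 1) (dir_deriv (1, 0) h)"

lemma real_polynomial_function_in_smooth_tensors:
  assumes "real_polynomial_function P"
  shows "P \<in> smooth_tensors"
  using assms
proof induction
  case (linear f)
  then interpret bounded_linear f .
  define a b where "a = f (1, 0)" and "b = f (0, 1)"
  have "f (x, y) = a * x + b * y" for x y
    using add[of "x *\<^sub>R (1, 0)" "y *\<^sub>R (0, 1)"] scale[of x "(1, 0)"] scale[of y "(0, 1)"]
    by (simp add: a_def b_def)
  then have "f = a *\<^sub>R tensor (\<lambda>x. x) (\<lambda>_. 1) + b *\<^sub>R tensor (\<lambda>_. 1) (\<lambda>y. y)"
    by (auto simp: tensor_eq)
  also have "\<dots> \<in> smooth_tensors"
    by (intro span_add span_scale span_base tensor_in_tensors)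
      (simp_all add: smooth_fun_if_derivative_smooth[OF DERIV_ident] smooth_fun_const)
  finally show ?case .
next
  case (const c)
  have "(\<lambda>_. c) = tensor (\<lambda>_. c) (\<lambda>_. 1)" by (simp add: tensor_eq)
  also have "\<dots> \<in> smooth_tensors"
    by (intro span_base tensor_in_tensors) (simp_all add: smooth_fun_const)
  finally show ?case .
next
  case (add f g)
  show ?case using span_add[OF add.IH] by (simp only: plus_fun_def)
next
  case (mult f g)
  have "h * k \<in> smooth_tensors"
    if "h \<in> tensors (Collect smooth_fun) (Collect smooth_fun)"
      "k \<in> tensors (Collect smooth_fun) (Collect smooth_fun)" for h k
    using that
    by (auto elim!: tensorsE simp: tensor_mult intro!: span_base tensor_in_tensors smooth_fun_mult)
  then show ?case
    using span_mult[OF _ mult.IH] by (simp only: times_fun_def)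
qed

lemma mixed_deriv_antiderivative_exists:
  assumes "P \<in> smooth_tensors"
  shows "\<exists>S\<in>smooth_tensors.
    (\<forall>y. S (a, y) = 0) \<and> (\<forall>x. S (x, c) = 0) \<and> mixed_deriv S = P"
  using assms
proof (induction rule: span_induct_alt)
  case base
  show ?case
    by (intro bexI[OF _ span_zero]) (simp add: zero_fun_def)
next
  case (step k h P)
  then obtain p q where pq: "smooth_fun p" "smooth_fun q" "h = tensor p q"
    by (auto elim!: tensorsE)
  obtain S where S: "S \<in> smooth_tensors"
    "\<And>y. S (a, y) = 0" "\<And>x. S (x, c) = 0" "mixed_deriv S = P"
    using step.IH by blast
  obtain p' where p': "smooth_fun p'" "p' a = 0" "\<And>x. (p' has_real_derivative p x) (at x)"
    using smooth_antiderivative_exists[OF pq(1)] by blast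
  obtain q' where q': "smooth_fun q'" "q' c = 0" "\<And>x. (q' has_real_derivative q x) (at x)"
    using smooth_antiderivative_exists[OF pq(2)] by blast
  have smooth: "smooth_fun S" "smooth_fun (dir_deriv (1, 0) S)"
      "smooth_fun (tensor p' q')" "smooth_fun (tensor p q')"
    using S(1) smooth_tensors_subset_smooth_fun p'(1) q'(1) pq(1)
    by (auto simp: Basis_real_prod intro: smooth_fun_tensor smooth_fun_dir_deriv)
  note diff = smooth[THEN smooth_fun_differentiable]
    smooth[THEN smooth_fun_scaleR, THEN smooth_fun_differentiable]
  have "mixed_deriv (k *\<^sub>R tensor p' q' + S) = k *\<^sub>R tensor p q + P"
    by (simp only: dir_deriv_add dir_deriv_scaleR diff dir_deriv_tensor p'(1) q'(1) pq(1)
        dir_deriv_real_eqI[OF p'(3)] dir_deriv_real_eqI[OF q'(3)] S(4))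
  moreover have "k *\<^sub>R tensor p' q' + S \<in> smooth_tensors"
    using p'(1) q'(1) by (intro span_add span_scale span_base tensor_in_tensors S(1)) simp_all
  moreover have "(k *\<^sub>R tensor p' q' + S) (a, y) = 0" "(k *\<^sub>R tensor p' q' + S) (x, c) = 0" for x y
    by (simp_all add: tensor_eq S p'(2) q'(2))
  ultimately show ?case
    unfolding pq(3) by blast
qed

lemma
  assumes "smooth_fun (h :: real \<times> real \<Rightarrow> real)"
  shows smooth_fun_has_real_derivative_fst:
      "((\<lambda>t. h (t, y)) has_real_derivative dir_deriv (1, 0) h (x, y)) (at x)"
    and smooth_fun_has_real_derivative_snd:
      "((\<lambda>t. h (x, t)) has_real_derivative dir_deriv (0, 1) h (x, y)) (at y)"
  using differentiable_line_has_real_derivative[of h "(0, y)" x "(1, 0)"]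
    differentiable_line_has_real_derivative[of h "(x, 0)" y "(0, 1)"]
  by (simp_all add: smooth_fun_differentiable assms)

lemma has_real_derivative_abs_le_Lipschitz:
  fixes f :: "real \<Rightarrow> real"
  assumes deriv: "(f has_real_derivative d) (at x)" and "a < b" "x \<in> {a..b}"
    and lipschitz: "\<And>y. y \<in> {a..b} \<Longrightarrow> \<bar>f y - f x\<bar> \<le> B * \<bar>y - x\<bar>"
  shows "\<bar>d\<bar> \<le> B"
proof (rule tendsto_upperbound)
  show "((\<lambda>y. \<bar>(f y - f x) / (y - x)\<bar>) \<longlongrightarrow> \<bar>d\<bar>) (at x within {a..b})"
    using has_field_derivative_at_within[OF deriv] unfolding has_field_derivative_iff
    by (rule tendsto_rabs)
  show "\<forall>\<^sub>F y in at x within {a..b}. \<bar>(f y - f x) / (y - x)\<bar> \<le> B"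
    unfolding eventually_at_filter
    by (rule always_eventually) (use lipschitz in \<open>auto simp: abs_divide divide_le_eq\<close>)
  show "at x within {a..b} \<noteq> bot"
    using assms(2,3) by (simp add: trivial_limit_within islimpt_Icc)
qed

context
  fixes E :: "real \<times> real \<Rightarrow> real" and a b c d e :: real
  assumes E: "smooth_fun E"
    and mixed: "\<And>z. z \<in> {a..b} \<times> {c..d} \<Longrightarrow> \<bar>mixed_deriv E z\<bar> \<le> e"
begin

lemma rectangle_increment_le_of_mixed_deriv_le:
  assumes x: "x\<^sub>1 \<in> {a..b}" "x\<^sub>2 \<in> {a..b}" and y: "y\<^sub>1 \<in> {c..d}" "y\<^sub>2 \<in> {c..d}"
  shows "\<bar>(E (x\<^sub>2, y\<^sub>2) - E (x\<^sub>2, y\<^sub>1)) - (E (x\<^sub>1, y\<^sub>2) - E (x\<^sub>1, y\<^sub>1))\<bar>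
    \<le> e * \<bar>y\<^sub>2 - y\<^sub>1\<bar> * \<bar>x\<^sub>2 - x\<^sub>1\<bar>"
proof -
  have dE: "smooth_fun (dir_deriv (1, 0) E)"
    using E by (intro smooth_fun_dir_deriv) (simp_all add: Basis_real_prod)
  have dx_le: "\<bar>dir_deriv (1, 0) E (t, y\<^sub>2) - dir_deriv (1, 0) E (t, y\<^sub>1)\<bar> \<le> e * \<bar>y\<^sub>2 - y\<^sub>1\<bar>"
    if "t \<in> {a..b}" for t
    using field_differentiable_bound[of "{c..d}" "\<lambda>u. dir_deriv (1, 0) E (t, u)"
        "\<lambda>u. mixed_deriv E (t, u)" e y\<^sub>2 y\<^sub>1] mixed[of "(t, _)"] that y
      smooth_fun_has_real_derivative_snd[OF dE, THEN has_field_derivative_at_within]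
    by simp
  have "((\<lambda>t. E (t, y\<^sub>2) - E (t, y\<^sub>1)) has_real_derivative
      dir_deriv (1, 0) E (t, y\<^sub>2) - dir_deriv (1, 0) E (t, y\<^sub>1)) (at t within {a..b})" for t
    by (intro has_field_derivative_at_within[OF DERIV_diff] smooth_fun_has_real_derivative_fst E)
  then show ?thesis
    using field_differentiable_bound[of "{a..b}" "\<lambda>t. E (t, y\<^sub>2) - E (t, y\<^sub>1)"
        "\<lambda>t. dir_deriv (1, 0) E (t, y\<^sub>2) - dir_deriv (1, 0) E (t, y\<^sub>1)"
        "e * \<bar>y\<^sub>2 - y\<^sub>1\<bar>" x\<^sub>2 x\<^sub>1] dx_le x
    by simp
qed

context
  assumes ab: "a < b" and cd: "c < d"
    and E_left: "\<And>y. E (a, y) = 0" and E_bottom: "\<And>x. E (x, c) = 0"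
begin

lemma horizontal_increment_le_of_mixed_deriv_le:
  assumes x: "x \<in> {a..b}" "x' \<in> {a..b}" and y: "y \<in> {c..d}"
  shows "\<bar>E (x', y) - E (x, y)\<bar> \<le> e * (d - c) * \<bar>x' - x\<bar>"
proof -
  have "0 \<le> e"
    using mixed[of "(x, y)"] x y by auto
  have "\<bar>E (x', y) - E (x, y)\<bar> \<le> e * \<bar>y - c\<bar> * \<bar>x' - x\<bar>"
    using rectangle_increment_le_of_mixed_deriv_le[of x x' c y] x y cd by (simp add: E_bottom)
  also have "\<dots> \<le> e * (d - c) * \<bar>x' - x\<bar>"
    using y \<open>0 \<le> e\<close> by (intro mult_right_mono mult_left_mono) auto
  finally show ?thesis .
qed

lemma vertical_increment_le_of_mixed_deriv_le:
  assumes x: "x \<in> {a..b}" and y: "y \<in> {c..d}" "y' \<in> {c..d}"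
  shows "\<bar>E (x, y') - E (x, y)\<bar> \<le> e * (b - a) * \<bar>y' - y\<bar>"
proof -
  have "0 \<le> e"
    using mixed[of "(x, y)"] x y by auto
  have "\<bar>E (x, y') - E (x, y)\<bar> \<le> e * \<bar>y' - y\<bar> * \<bar>x - a\<bar>"
    using rectangle_increment_le_of_mixed_deriv_le[of a x y y'] x y ab by (simp add: E_left)
  also have "\<dots> \<le> e * \<bar>y' - y\<bar> * (b - a)"
    using x \<open>0 \<le> e\<close> by (intro mult_left_mono) auto
  finally show ?thesis by (simp add: mult_ac)
qed

text \<open>Bounding both first partial derivatives by Lipschitz estimates avoids the symmetry of second
  derivatives.\<close>

lemma C1_size_le_of_mixed_deriv_le:
  assumes z: "z \<in> {a..b} \<times> {c..d}"
  shows "C1_size E z \<le> e * ((b - a) * (d - c) + (b - a) + (d - c))"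
proof -
  obtain x y where xy: "z = (x, y)" "x \<in> {a..b}" "y \<in> {c..d}"
    using z by blast
  have "\<bar>dir_deriv (1, 0) E (x, y)\<bar> \<le> e * (d - c)"
    using smooth_fun_has_real_derivative_fst[OF E] ab xy(2)
    by (rule has_real_derivative_abs_le_Lipschitz)
      (intro horizontal_increment_le_of_mixed_deriv_le xy)
  moreover have "\<bar>dir_deriv (0, 1) E (x, y)\<bar> \<le> e * (b - a)"
    using smooth_fun_has_real_derivative_snd[OF E] cd xy(3)
    by (rule has_real_derivative_abs_le_Lipschitz)
      (intro vertical_increment_le_of_mixed_deriv_le xy)
  moreover have "\<bar>E (x, y)\<bar> \<le> e * (b - a) * (d - c)"
  proof -
    have "0 \<le> e"
      using mixed[OF z] by linarith
    have "\<bar>E (x, y)\<bar> \<le> e * (b - a) * \<bar>y - c\<bar>"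
      using vertical_increment_le_of_mixed_deriv_le[of x c y] xy cd by (simp add: E_bottom)
    also have "\<dots> \<le> e * (b - a) * (d - c)"
      using xy \<open>0 \<le> e\<close> ab by (intro mult_left_mono) auto
    finally show ?thesis .
  qed
  moreover have "norm (cgrad E z) \<le> \<bar>dir_deriv (1, 0) E (x, y)\<bar> + \<bar>dir_deriv (0, 1) E (x, y)\<bar>"
    by (simp add: xy(1) cgrad_real_prod norm_Pair sqrt_sum_squares_le_sum_abs)
  ultimately show ?thesis
    by (simp add: C1_size_def xy(1) algebra_simps)
qed

end

end

lemma smooth_fun_approx_smooth_tensors:
  fixes \<phi> :: "real \<times> real \<Rightarrow> real"
  assumes \<phi>: "smooth_fun \<phi>" and ab: "a < b" and cd: "c < d"
    and \<phi>_left: "\<And>y. \<phi> (a, y) = 0" and \<phi>_bottom: "\<And>x. \<phi> (x, c) = 0" and "\<epsilon> > 0"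
  shows "\<exists>S\<in>smooth_tensors.
    \<forall>z\<in>{a..b} \<times> {c..d}. C1_size (S - \<phi>) z \<le> \<epsilon>"
proof -
  define M where "M = (b - a) * (d - c) + (b - a) + (d - c)"
  have "M > 0"
    unfolding M_def using ab cd by (intro add_pos_pos mult_pos_pos) simp_all
  have bases: "(1, 0) \<in> (Basis :: (real \<times> real) set)" "(0, 1) \<in> (Basis :: (real \<times> real) set)"
    by (simp_all add: Basis_real_prod)
  have "continuous_on ({a..b} \<times> {c..d}) (mixed_deriv \<phi>)"
    using \<phi> by (intro smooth_fun_continuous_on smooth_fun_dir_deriv bases)
  then obtain P where P: "real_polynomial_function P"
    "\<And>z. z \<in> {a..b} \<times> {c..d} \<Longrightarrow> \<bar>mixed_deriv \<phi> z - P z\<bar> < \<epsilon> / M"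
    using Stone_Weierstrass_real_polynomial_function[of "{a..b} \<times> {c..d}" "mixed_deriv \<phi>" "\<epsilon> / M"]
      \<open>\<epsilon> > 0\<close> \<open>M > 0\<close> by (auto simp: compact_Times)
  obtain S where S: "S \<in> smooth_tensors"
    "\<And>y. S (a, y) = 0" "\<And>x. S (x, c) = 0" "mixed_deriv S = P"
    using mixed_deriv_antiderivative_exists
      [OF real_polynomial_function_in_smooth_tensors[OF P(1)]] by blast
  have "smooth_fun S"
    using S(1) smooth_tensors_subset_smooth_fun by blast
  have "mixed_deriv (S - \<phi>) = P - mixed_deriv \<phi>"
    using \<open>smooth_fun S\<close> \<phi> bases
    by (simp only: dir_deriv_diff smooth_fun_differentiable smooth_fun_dir_deriv S(4))
  from fun_cong[OF this] have mixed_le: "\<bar>mixed_deriv (S - \<phi>) z\<bar> \<le> \<epsilon> / M"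
    if "z \<in> {a..b} \<times> {c..d}" for z
    using P(2)[OF that] by simp
  have "C1_size (S - \<phi>) z \<le> \<epsilon> / M * ((b - a) * (d - c) + (b - a) + (d - c))"
    if "z \<in> {a..b} \<times> {c..d}" for z
    using smooth_fun_diff[OF \<open>smooth_fun S\<close> \<phi>] mixed_le ab cd _ _ that
    by (rule C1_size_le_of_mixed_deriv_le) (simp_all add: S \<phi>_left \<phi>_bottom)
  then have "C1_size (S - \<phi>) z \<le> \<epsilon>" if "z \<in> {a..b} \<times> {c..d}" for z
    using that \<open>M > 0\<close> by (simp flip: M_def)
  with S(1) show ?thesis by blast
qed

lemma compact_real_interval_cutoff_exists:
  fixes U K :: "real set"
  assumes U: "open U" "connected U" and K: "compact K" "K \<subseteq> U"
  obtains a b \<eta> where "a < b" "a \<notin> K" "test_fun U \<eta>"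
    "\<And>x. x \<in> K \<Longrightarrow> \<eta> x = 1" "\<And>x. x \<notin> {a..b} \<Longrightarrow> \<eta> x = 0"
proof (cases "K = {}")
  case True
  have "test_fun U 0"
    using subspace_0[OF subspace_test_fun] by simp
  then show thesis
    using True by (intro that[of 0 1 0]) simp_all
next
  case False
  obtain \<alpha> where \<alpha>: "\<alpha> \<in> K" "\<And>x. x \<in> K \<Longrightarrow> \<alpha> \<le> x"
    using compact_attains_inf[OF K(1) False] by auto
  obtain \<beta> where \<beta>: "\<beta> \<in> K" "\<And>x. x \<in> K \<Longrightarrow> x \<le> \<beta>"
    using compact_attains_sup[OF K(1) False] by auto
  obtain d\<^sub>1 where d\<^sub>1: "d\<^sub>1 > 0" "cball \<alpha> d\<^sub>1 \<subseteq> U"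
    using U(1) \<alpha>(1) K(2) open_contains_cball by blast
  obtain d\<^sub>2 where d\<^sub>2: "d\<^sub>2 > 0" "cball \<beta> d\<^sub>2 \<subseteq> U"
    using U(1) \<beta>(1) K(2) open_contains_cball by blast
  define \<delta> where "\<delta> = min d\<^sub>1 d\<^sub>2"
  have "\<delta> > 0" using d\<^sub>1(1) d\<^sub>2(1) by (simp add: \<delta>_def)
  have "\<alpha> - \<delta> \<in> cball \<alpha> d\<^sub>1" "\<beta> + \<delta> \<in> cball \<beta> d\<^sub>2"
    using d\<^sub>1(1) d\<^sub>2(1) by (simp_all add: \<delta>_def dist_real_def)
  then have interval: "{\<alpha> - \<delta>..\<beta> + \<delta>} \<subseteq> U"
    using d\<^sub>1(2) d\<^sub>2(2) connected_contains_Icc[OF U(2)] by blast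
  obtain \<eta> where \<eta>: "smooth_fun \<eta>" "\<And>x. x \<in> {\<alpha>..\<beta>} \<Longrightarrow> \<eta> x = 1"
      "\<And>x. x \<notin> {\<alpha> - \<delta>..\<beta> + \<delta>} \<Longrightarrow> \<eta> x = 0"
    using smooth_cutoff_exists[OF \<open>\<delta> > 0\<close>] by blast
  show thesis
  proof (rule that[OF _ _ _ _ \<eta>(3)])
    show "\<alpha> - \<delta> < \<beta> + \<delta>" "\<alpha> - \<delta> \<notin> K"
      using \<alpha>(2)[of \<beta>] \<alpha>(2)[of "\<alpha> - \<delta>"] \<beta>(1) \<open>\<delta> > 0\<close> by auto
    show "test_fun U \<eta>"
      by (rule test_funI[OF \<eta>(1) compact_Icc interval \<eta>(3)])
    show "\<eta> x = 1" if "x \<in> K" for x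
      using that \<alpha>(2) \<beta>(2) by (simp add: \<eta>(2))
  qed
qed

lemma test_fun_tensor_cutoff_exists:
  fixes A B :: "real set"
  assumes A: "open A" "connected A" and B: "open B" "connected B" and \<phi>: "test_fun (A \<times> B) \<phi>"
  obtains a b c d \<eta> \<zeta> where "a < b" "c < d" "test_fun A \<eta>" "test_fun B \<zeta>"
    "tensor \<eta> \<zeta> * \<phi> = \<phi>" "\<And>z. z \<notin> {a..b} \<times> {c..d} \<Longrightarrow> tensor \<eta> \<zeta> z = 0"
    "\<And>y. \<phi> (a, y) = 0" "\<And>x. \<phi> (x, c) = 0"
proof -
  obtain K where K: "compact K" "K \<subseteq> A \<times> B" "\<And>z. z \<notin> K \<Longrightarrow> \<phi> z = 0"
    using \<phi> by (rule test_funE) blast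
  have K_fst: "compact (fst ` K)" "fst ` K \<subseteq> A" and K_snd: "compact (snd ` K)" "snd ` K \<subseteq> B"
    using K(1,2) by (auto intro!: compact_continuous_image continuous_intros)
  obtain a b \<eta> where \<eta>: "a < b" "a \<notin> fst ` K" "test_fun A \<eta>"
      "\<And>x. x \<in> fst ` K \<Longrightarrow> \<eta> x = 1" "\<And>x. x \<notin> {a..b} \<Longrightarrow> \<eta> x = 0"
    using compact_real_interval_cutoff_exists[OF A K_fst] by blast
  obtain c d \<zeta> where \<zeta>: "c < d" "c \<notin> snd ` K" "test_fun B \<zeta>"
      "\<And>y. y \<in> snd ` K \<Longrightarrow> \<zeta> y = 1" "\<And>y. y \<notin> {c..d} \<Longrightarrow> \<zeta> y = 0"
    using compact_real_interval_cutoff_exists[OF B K_snd] by blast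
  show thesis
  proof (rule that[OF \<eta>(1) \<zeta>(1) \<eta>(3) \<zeta>(3)])
    have "(tensor \<eta> \<zeta> * \<phi>) z = \<phi> z" for z
      using \<eta>(4) \<zeta>(4) K(3)[of z] by (cases "z \<in> K") (simp_all add: tensor_eq)
    then show "tensor \<eta> \<zeta> * \<phi> = \<phi>" by (rule ext)
    show "tensor \<eta> \<zeta> z = 0" if "z \<notin> {a..b} \<times> {c..d}" for z
      using that \<eta>(5)[of "fst z"] \<zeta>(5)[of "snd z"] by (cases z) (auto simp: tensor_eq)
    show "\<phi> (a, y) = 0" "\<phi> (x, c) = 0" for x y
      using K(3) \<eta>(2) \<zeta>(2) by force+
  qed
qed

lemma norm_cgrad_cutoff_mult_le:
  assumes "smooth_fun w" "smooth_fun h" and Q: "compact Q" "\<And>z. z \<notin> Q \<Longrightarrow> w z = 0"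
    and w_le: "\<And>z. C1_size w z \<le> C" and h_le: "\<And>z. z \<in> Q \<Longrightarrow> C1_size h z \<le> e" and "0 \<le> C * e"
  shows "norm (cgrad (w * h) z) \<le> C * e"
proof (cases "z \<in> Q")
  case True
  have nonneg: "0 \<le> C1_size f x" for f :: "'a \<Rightarrow> real" and x
    by (simp add: C1_size_def)
  have "norm (cgrad (w * h) z) \<le> C1_size w z * C1_size h z"
    by (rule norm_cgrad_mult_le[OF assms(1,2)])
  also have "\<dots> \<le> C * e"
    using order_trans[OF nonneg w_le] by (intro mult_mono w_le h_le[OF True] nonneg)
  finally show ?thesis .
next
  case False
  have "dir_deriv i (w * h) z = 0" for i
    using Q False by (intro dir_deriv_zero_outside[of Q]) simp_all
  then show ?thesis
    using \<open>0 \<le> C * e\<close> by (simp add: cgrad_def)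
qed

text \<open>Approximate the mixed derivative of \<open>\<phi>\<close> by a polynomial, integrate it twice and
  multiply the result by a cutoff which is 1 on the support of \<open>\<phi>\<close>.\<close>

lemma test_fun_approx_test_tensors:
  fixes A B :: "real set"
  assumes A: "open A" "connected A" and B: "open B" "connected B"
    and \<phi>: "test_fun (A \<times> B) \<phi>" and "\<epsilon> > 0"
  shows "\<exists>S\<in>test_tensors A B. \<forall>z. norm (cgrad (S - \<phi>) z) \<le> \<epsilon>"
proof -
  obtain a b c d \<eta> \<zeta> where ab: "a < b" and cd: "c < d" and cutoffs: "test_fun A \<eta>" "test_fun B \<zeta>"
    and cutoff_one: "tensor \<eta> \<zeta> * \<phi> = \<phi>"
    and cutoff_zero: "\<And>z. z \<notin> {a..b} \<times> {c..d} \<Longrightarrow> tensor \<eta> \<zeta> z = 0"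
    and \<phi>_zero: "\<And>y. \<phi> (a, y) = 0" "\<And>x. \<phi> (x, c) = 0"
    using test_fun_tensor_cutoff_exists[OF A B \<phi>] by blast
  note cutoff = test_fun_tensor[OF cutoffs]
  obtain C where C: "C > 0" "\<And>z. C1_size (tensor \<eta> \<zeta>) z \<le> C"
    using test_fun_C1_size_bounded[OF cutoff] by blast
  obtain S where S: "S \<in> smooth_tensors"
    "\<And>z. z \<in> {a..b} \<times> {c..d} \<Longrightarrow> C1_size (S - \<phi>) z \<le> \<epsilon> / C"
    using smooth_fun_approx_smooth_tensors[OF test_fun_smooth[OF \<phi>] ab cd \<phi>_zero, of "\<epsilon> / C"]
      \<open>\<epsilon> > 0\<close> C(1) by auto
  have smooth: "smooth_fun (tensor \<eta> \<zeta>)" "smooth_fun (S - \<phi>)"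
    using S(1) smooth_tensors_subset_smooth_fun cutoff \<phi>
    by (auto intro: test_fun_smooth smooth_fun_diff)
  have "norm (cgrad (tensor \<eta> \<zeta> * (S - \<phi>)) z) \<le> C * (\<epsilon> / C)" for z
    using \<open>\<epsilon> > 0\<close> C(1)
    by (intro norm_cgrad_cutoff_mult_le[OF smooth _ cutoff_zero C(2) S(2)])
      (simp_all add: compact_Times)
  then have "norm (cgrad (tensor \<eta> \<zeta> * S - \<phi>) z) \<le> \<epsilon>" for z
    using C(1) by (simp add: right_diff_distrib cutoff_one)
  moreover have "tensor \<eta> \<zeta> * S \<in> test_tensors A B"
  proof (rule span_mult)
    show "f * h \<in> test_tensors A B"
      if "f \<in> {tensor \<eta> \<zeta>}" "h \<in> tensors (Collect smooth_fun) (Collect smooth_fun)" for f h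
      using that cutoffs
      by (auto elim!: tensorsE simp: tensor_mult intro!: span_base tensor_in_tensors test_fun_mult)
  qed (use S(1) in \<open>simp_all add: span_base\<close>)
  ultimately show ?thesis by blast
qed

lemma H10_approx_test_fun:
  assumes U: "open U" and u: "u \<in> H10 U" and "\<epsilon> > 0"
  obtains \<phi> where "test_fun U \<phi>" "dirichlet_norm U (\<phi> - u) \<le> \<epsilon>"
proof -
  obtain G where G: "is_H10_grad U u G"
    using u by (auto simp: H10_def)
  then obtain \<phi> where \<phi>: "\<And>k. test_fun U (\<phi> k)"
    "(\<lambda>k. L2_norm (lebesgue_on U) (cgrad (\<phi> k) - G)) \<longlonglongrightarrow> 0"
    by (rule is_H10_gradE) blast
  obtain k where "L2_norm (lebesgue_on U) (cgrad (\<phi> k) - G) < \<epsilon>"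
    using order_tendstoD(2)[OF \<phi>(2) \<open>\<epsilon> > 0\<close>] by (auto simp: eventually_sequentially)
  moreover have "is_H10_grad U (\<phi> k - u) (cgrad (\<phi> k) - G)"
    by (intro is_H10_grad_diff is_H10_grad_test_fun U G \<phi>(1))
  ultimately show thesis
    using that[OF \<phi>(1)[of k]] by (simp add: dirichlet_norm_eq_L2_norm[OF U])
qed

lemma dirichlet_norm_test_fun_le:
  assumes U: "open U" "bounded U" and \<phi>: "test_fun U \<phi>" and bound: "\<And>x. norm (cgrad \<phi> x) \<le> C"
  shows "dirichlet_norm U \<phi> \<le> sqrt (measure (lebesgue_on U) U) * C"
proof -
  have "finite_measure (lebesgue_on U)"
    using U by (intro finite_measure_lebesgue_on lmeasurable_open)
  from L2_norm_le_of_bounded[OF this sq_integrable_cgrad[OF U(1) \<phi>] bound] show ?thesis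
    by (simp add: dirichlet_norm_eq_L2_norm[OF U(1) is_H10_grad_test_fun[OF U(1) \<phi>]])
qed

lemma H10_approx_span_tensors:
  fixes A B :: "real set"
  assumes A: "bounded_domain A" and B: "bounded_domain B"
    and u: "u \<in> H10 (A \<times> B)" and "\<epsilon> > 0"
  shows "\<exists>S\<in>span (tensors (H10 A) (H10 B)). dirichlet_norm (A \<times> B) (u - S) \<le> \<epsilon>"
proof -
  let ?U = "A \<times> B"
  have AB: "open A" "connected A" "open B" "connected B"
    using A B by (simp_all add: bounded_domain_def)
  have U: "open ?U" "bounded ?U"
    using A B by (simp_all add: bounded_domain_def open_Times bounded_Times)
  interpret H10: semi_inner_product "H10 ?U" "dirichlet ?U"
    by (rule semi_inner_product_dirichlet[OF U(1)])
  obtain \<phi> where \<phi>: "test_fun ?U \<phi>" "dirichlet_norm ?U (\<phi> - u) \<le> \<epsilon> / 2"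
    using H10_approx_test_fun[OF U(1) u, of "\<epsilon> / 2"] \<open>\<epsilon> > 0\<close> by auto
  define m where "m = sqrt (measure (lebesgue_on ?U) ?U) + 1"
  have "m > 0" by (simp add: m_def add_nonneg_pos)
  obtain S where S: "S \<in> test_tensors A B"
    "\<And>z. norm (cgrad (S - \<phi>) z) \<le> \<epsilon> / 2 / m"
    using test_fun_approx_test_tensors[OF AB \<phi>(1), of "\<epsilon> / 2 / m"] \<open>\<epsilon> > 0\<close> \<open>m > 0\<close> by auto
  have tests: "test_fun ?U S" "test_fun ?U (S - \<phi>)"
    using S(1) test_tensors_subset_test_fun \<phi>(1) by (auto intro: test_fun_diff)
  have "dirichlet_norm ?U (S - \<phi>) \<le> sqrt (measure (lebesgue_on ?U) ?U) * (\<epsilon> / 2 / m)"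
    by (rule dirichlet_norm_test_fun_le[OF U tests(2) S(2)])
  also have "\<dots> \<le> m * (\<epsilon> / 2 / m)"
    using \<open>\<epsilon> > 0\<close> \<open>m > 0\<close> by (intro mult_right_mono) (simp_all add: m_def)
  finally have "dirichlet_norm ?U (S - \<phi>) \<le> \<epsilon> / 2"
    using \<open>m > 0\<close> by simp
  then have "dirichlet_norm ?U (u - S) \<le> \<epsilon>"
    using H10.seminorm_diff_triangle[of S \<phi> u] H10.seminorm_minus_commute[of S u] \<phi>(2) u
      test_fun_in_H10[OF U(1)] \<phi>(1) tests(1) by simp
  moreover have "tensors (Collect (test_fun A)) (Collect (test_fun B)) \<subseteq> tensors (H10 A) (H10 B)"
    using AB by (intro tensors_mono) (auto intro: test_fun_in_H10)
  ultimately show ?thesis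
    using S(1) span_mono by blast
qed

subsection \<open>The greedy algorithm for tensor products\<close>

lemma pure_greedy_tensors_tendsto_0:
  fixes A B :: "real set"
  assumes A: "bounded_domain A" and B: "bounded_domain B"
    and functionals: "residual_functionals (H10 (A \<times> B)) (dirichlet (A \<times> B)) g t l"
    and steps: "\<And>n. t n \<in> tensors (H10 A) (H10 B)"
    and minimal: "\<And>n \<rho> \<sigma>. \<rho> \<in> H10 A \<Longrightarrow> \<sigma> \<in> H10 B \<Longrightarrow>
      1/2 * dirichlet (A \<times> B) (t n) (t n) - l n (t n)
        \<le> 1/2 * dirichlet (A \<times> B) (tensor \<rho> \<sigma>) (tensor \<rho> \<sigma>) - l n (tensor \<rho> \<sigma>)"
  shows "(\<lambda>n. dirichlet (A \<times> B) (residual g t n) (residual g t n)) \<longlonglongrightarrow> 0"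
proof -
  have "open A" "open B"
    using A B by (simp_all add: bounded_domain_def)
  interpret residual_functionals "H10 (A \<times> B)" "dirichlet (A \<times> B)" g t l
    by (rule functionals)
  interpret pure_greedy "H10 (A \<times> B)" "dirichlet (A \<times> B)" g t l "tensors (H10 A) (H10 B)"
  proof
    show "tensors (H10 A) (H10 B) \<subseteq> H10 (A \<times> B)"
      by (rule tensors_H10_subset[OF \<open>open A\<close> \<open>open B\<close>])
    show "c *\<^sub>R v \<in> tensors (H10 A) (H10 B)" if "v \<in> tensors (H10 A) (H10 B)" for c v
      using tensors_scaleR[OF subspace_H10[OF \<open>open A\<close>] that] .
    show "1/2 * dirichlet (A \<times> B) (t n) (t n) - l n (t n) \<le> 1/2 * dirichlet (A \<times> B) v v - l n v"
      if "v \<in> tensors (H10 A) (H10 B)" for n v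
      using that by (rule tensorsE) (simp only: minimal)
  qed (rule steps)
  show ?thesis
    by (rule energy_residual_tendsto_0) (rule H10_approx_span_tensors[OF A B g_mem])
qed

theorem theorem1:
  fixes Ox Oy :: "real set"
    and f g :: "real \<times> real \<Rightarrow> real"
    and r s :: "nat \<Rightarrow> real \<Rightarrow> real"
    and fs :: "nat \<Rightarrow> (real \<times> real \<Rightarrow> real) \<Rightarrow> real"
  assumes dom_x: "bounded_domain Ox" and dom_y: "bounded_domain Oy"
    and f_L2: "f \<in> L2 (Ox \<times> Oy)"
    and g_H10: "g \<in> H10 (Ox \<times> Oy)"
    and g_sol: "\<forall>v\<in>H10 (Ox \<times> Oy).
        dirichlet (Ox \<times> Oy) g v = integral\<^sup>L (lebesgue_on (Ox \<times> Oy)) (\<lambda>z. f z * v z)"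
    and rs_H10: "\<forall>n\<ge>1. r n \<in> H10 Ox \<and> s n \<in> H10 Oy"
    and fs_0: "\<forall>v\<in>H10 (Ox \<times> Oy).
        fs 0 v = integral\<^sup>L (lebesgue_on (Ox \<times> Oy)) (\<lambda>z. f z * v z)"
    and fs_rec: "\<forall>n\<ge>1. \<forall>v\<in>H10 (Ox \<times> Oy).
        fs n v = fs (n - 1) v - dirichlet (Ox \<times> Oy) (tensor (r n) (s n)) v"
    and galerkin: "\<forall>n\<ge>1. \<forall>\<rho>\<in>H10 Ox. \<forall>\<sigma>\<in>H10 Oy.
        dirichlet (Ox \<times> Oy) (tensor (r n) (s n)) (\<lambda>z. tensor (r n) \<sigma> z + tensor \<rho> (s n) z)
        = fs (n - 1) (\<lambda>z. tensor (r n) \<sigma> z + tensor \<rho> (s n) z)"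
  shows "summable (\<lambda>n. dirichlet (Ox \<times> Oy) (tensor (r (Suc n)) (s (Suc n)))
                                            (tensor (r (Suc n)) (s (Suc n))))
       \<and> summable (\<lambda>n. 1/2 * dirichlet (Ox \<times> Oy) (tensor (r (Suc n)) (s (Suc n)))
                                            (tensor (r (Suc n)) (s (Suc n)))
                        - fs n (tensor (r (Suc n)) (s (Suc n))))
       \<and> (\<Sum>n. dirichlet (Ox \<times> Oy) (tensor (r (Suc n)) (s (Suc n)))
                                    (tensor (r (Suc n)) (s (Suc n))))
         = - 2 * (\<Sum>n. 1/2 * dirichlet (Ox \<times> Oy) (tensor (r (Suc n)) (s (Suc n)))
                                            (tensor (r (Suc n)) (s (Suc n)))
                        - fs n (tensor (r (Suc n)) (s (Suc n))))
       \<and> ((\<forall>n\<ge>1. \<forall>\<rho>\<in>H10 Ox. \<forall>\<sigma>\<in>H10 Oy.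
              1/2 * dirichlet (Ox \<times> Oy) (tensor (r n) (s n)) (tensor (r n) (s n))
                - fs (n - 1) (tensor (r n) (s n))
              \<le> 1/2 * dirichlet (Ox \<times> Oy) (tensor \<rho> \<sigma>) (tensor \<rho> \<sigma>)
                - fs (n - 1) (tensor \<rho> \<sigma>))
          \<longrightarrow> (\<lambda>n. dirichlet (Ox \<times> Oy)
                      (\<lambda>z. g z - (\<Sum>k=1..n. tensor (r k) (s k) z))
                      (\<lambda>z. g z - (\<Sum>k=1..n. tensor (r k) (s k) z))) \<longlonglongrightarrow> 0)"
proof -
  let ?U = "Ox \<times> Oy"
  define t where "t n = tensor (r (Suc n)) (s (Suc n))" for n
  have domains: "open Ox" "open Oy"
    using dom_x dom_y by (simp_all add: bounded_domain_def)
  then interpret H10: semi_inner_product "H10 ?U" "dirichlet ?U"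
    by (intro semi_inner_product_dirichlet open_Times)
  have t_mem: "t n \<in> tensors (H10 Ox) (H10 Oy)" "t n \<in> H10 ?U" for n
    using rs_H10 by (simp_all add: t_def tensor_in_tensors tensor_in_H10 domains)
  interpret residual_functionals "H10 ?U" "dirichlet ?U" g t fs
    by standard (simp_all add: g_H10 t_mem fs_0 g_sol fs_rec flip: t_def)
  interpret galerkin_steps "H10 ?U" "dirichlet ?U" g t fs
  proof (standard, rule functional_eq_form_of_add_self[OF step_mem])
    show "dirichlet ?U (t n) (t n + t n) = fs n (t n + t n)" for n
      using galerkin[rule_format, of "Suc n" "r (Suc n)" "s (Suc n)"] rs_H10
      by (simp add: t_def plus_fun_def)
  qed
  have residual: "residual g t n = (\<lambda>z. g z - (\<Sum>k=1..n. tensor (r k) (s k) z))" for n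
    by (simp add: residual_def t_def fun_eq_iff sum.atLeast1_atMost_eq)
  note convergence = pure_greedy_tensors_tendsto_0
    [OF dom_x dom_y residual_functionals_axioms t_mem(1),
      unfolded residual, unfolded t_def, simplified]
  have "(\<forall>n\<ge>1. P n) \<longleftrightarrow> (\<forall>n. P (Suc n))" for P :: "nat \<Rightarrow> bool"
    by (auto simp: Suc_le_eq gr0_conv_Suc)
  then show ?thesis
    using summable_energy_steps step_objective_sums unfolding t_def
    by (auto simp: sums_iff intro!: convergence)
qed

end
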